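(* Let $(\mathfrak{u}_0,\mathfrak{u}_1,\mathfrak{u}_2)$ be the triple of normalized Weber functions. The generators $S,T$ of $\mathrm{PSL}_2(\mathbb{Z})$ act by $$(\mathfrak{u}_0,\mathfrak{u}_1,\mathfrak{u}_2)\circ S=(\mathfrak{u}_0,\ \zeta_8\mathfrak{u}_2,\ \zeta_8^{-1}\mathfrak{u}_1),\qquad (\mathfrak{u}_0,\mathfrak{u}_1,\mathfrak{u}_2)\circ T=(\zeta_{12}^{-1}\mathfrak{u}_1,\ \zeta_{24}\mathfrak{u}_0,\ \zeta_{24}\mathfrak{u}_2).$$ The resulting action of $\mathrm{PSL}_2(\mathbb{Z})=\langle S,T\rangle$ on Weber triples, $g\mapsto (\mathfrak{u}_0,\mathfrak{u}_1,\mathfrak{u}_2)\,\iota(g)$, factors through the quotient $\mathrm{SL}_2(\mathbb{Z}/48\mathbb{Z})/\{\pm1\}$. In particular, the elements $U=T^{-1}ST$, $V=T^{-2}ST^2$ and $W=ST^3$ act by permutations: $$(\mathfrak{u}_0,\mathfrak{u}_1,\mathfrak{u}_2)\,\iota(U)=(\mathfrak{u}_2,\mathfrak{u}_1,\mathfrak{u}_0),\quad (\mathfrak{u}_0,\mathfrak{u}_1,\mathfrak{u}_2)\,\iota(V)=(\mathfrak{u}_0,\mathfrak{u}_2,\mathfrak{u}_1),\quad (\mathfrak{u}_0,\mathfrak{u}_1,\mathfrak{u}_2)\,\iota(W)=(\mathfrak{u}_2,\mathfrak{u}_0,\mathfrak{u}_1).$$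
   Context: Write $\zeta_k=e^{2\pi i/k}$. For $\tau$ in the complex upper half plane let $\eta(\tau)=e^{2\pi i\tau/24}\prod_{k\ge1}(1-e^{2\pi i k\tau})$ be the Dedekind eta function. The Weber functions are $$\mathfrak{f}(\tau)=\zeta_{48}^{-1}\frac{\eta\left(\frac{\tau+1}{2}\right)}{\eta(\tau)},\quad \mathfrak{f}_1(\tau)=\frac{\eta\left(\frac{\tau}{2}\right)}{\eta(\tau)},\quad \mathfrak{f}_2(\tau)=\sqrt2\,\frac{\eta(2\tau)}{\eta(\tau)},$$ and the normalized Weber functions are $(\mathfrak{u}_0,\mathfrak{u}_1,\mathfrak{u}_2)=(\mathfrak{f},\ \zeta_{16}\mathfrak{f}_1,\ \zeta_{16}^{-1}\mathfrak{f}_2)$. The group $\mathrm{PSL}_2(\mathbb{Z})$ is generated by $S=\begin{pmatrix}0&-1\\1&0\end{pmatrix}$ and $T=\begin{pmatrix}1&1\\0&1\end{pmatrix}$, acting on the upper half plane by $S\tau=-1/\tau$ and $T\tau=\tau+1$; for a function $h$ and for $g=S,T$, $(h\circ g)(\tau)=h(g\tau)$, applied componentwise to triples. The action on Weber triples is the right action given by the group homomorphism $\iota:\mathrm{PSL}_2(\mathbb{Z})\to\mathrm{GL}_3(\mathbb{Q}(\zeta_{24}))$ determined by $$\iota(S)=\begin{pmatrix}1&0&0\\0&0&\zeta_8^{-1}\\0&\zeta_8&0\end{pmatrix},\qquad \iota(T)=\begin{pmatrix}0&\zeta_{24}&0\\ \zeta_{24}^{-2}&0&0\\0&0&\zeta_{24}\end{pmatrix},$$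 where triples are regarded as row vectors multiplied on the right by matrices. Thus for a word $g=g_1g_2\cdots g_r$ in $S^{\pm1},T^{\pm1}$, the triple is multiplied by $\iota(g_1)\iota(g_2)\cdots\iota(g_r)$. *)

theory Defs
  imports "HOL-Analysis.Analysis" "HOL-Algebra.Generated_Fields"
    "HOL-Algebra.Algebraic_Closure_Type"
begin

section \<open>Weber functions\<close>

definition zeta :: "nat \<Rightarrow> complex" where
  "zeta k = exp (2 * of_real pi * \<i> / of_nat k)"

definition upper_half_plane :: "complex set" where
  "upper_half_plane = {\<tau>. Im \<tau> > 0}"

text \<open>The functions below are total; they are only meaningful on \<^const>\<open>upper_half_plane\<close>,
  where the infinite product converges. The product index is shifted to start at 0.\<close>

definition eta :: "complex \<Rightarrow> complex" where
  "eta \<tau> = exp (2 * of_real pi * \<i> * \<tau> / 24) *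
     (\<Prod>k. 1 - exp (2 * of_real pi * \<i> * of_nat (Suc k) * \<tau>))"

definition weber_f :: "complex \<Rightarrow> complex" where
  "weber_f \<tau> = inverse (zeta 48) * (eta ((\<tau> + 1) / 2) / eta \<tau>)"

definition weber_f1 :: "complex \<Rightarrow> complex" where
  "weber_f1 \<tau> = eta (\<tau> / 2) / eta \<tau>"

definition weber_f2 :: "complex \<Rightarrow> complex" where
  "weber_f2 \<tau> = of_real (sqrt 2) * (eta (2 * \<tau>) / eta \<tau>)"

definition u0 :: "complex \<Rightarrow> complex" where
  "u0 \<tau> = weber_f \<tau>"

definition u1 :: "complex \<Rightarrow> complex" where
  "u1 \<tau> = zeta 16 * weber_f1 \<tau>"

definition u2 :: "complex \<Rightarrow> complex" where
  "u2 \<tau> = inverse (zeta 16) * weber_f2 \<tau>"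

definition weber_triple :: "complex \<Rightarrow> complex^3" where
  "weber_triple \<tau> = vector [u0 \<tau>, u1 \<tau>, u2 \<tau>]"

section \<open>The modular group and its reduction\<close>

definition SL2 :: "('a::comm_ring_1^2^2) monoid" where
  "SL2 = \<lparr>carrier = {A. det A = 1}, monoid.mult = (**), one = mat 1\<rparr>"

definition PSL2 :: "('a::comm_ring_1^2^2) set monoid" where
  "PSL2 = SL2 Mod {mat 1, - mat 1}"

text \<open>For the ring of integers, \<^const>\<open>PSL2\<close> is the modular group. Over the numeral type \<open>48\<close>,
  whose arithmetic is that of the integers modulo 48, it is only the quotient by \<open>{1, -1}\<close>,
  not by all scalar matrices of determinant 1.\<close>

abbreviation PSL2Z :: "(int^2^2) set monoid" where
  "PSL2Z \<equiv> PSL2"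

abbreviation PSL2_48 :: "(48^2^2) set monoid" where
  "PSL2_48 \<equiv> PSL2"

definition psl :: "int^2^2 \<Rightarrow> (int^2^2) set" where
  "psl A = {mat 1, - mat 1} #>\<^bsub>SL2\<^esub> A"

definition psl_S :: "(int^2^2) set" where
  "psl_S = psl (vector [vector [0, -1], vector [1, 0]])"

definition psl_T :: "(int^2^2) set" where
  "psl_T = psl (vector [vector [1, 1], vector [0, 1]])"

definition psl_U :: "(int^2^2) set" where
  "psl_U = inv\<^bsub>PSL2Z\<^esub> psl_T \<otimes>\<^bsub>PSL2Z\<^esub> psl_S \<otimes>\<^bsub>PSL2Z\<^esub> psl_T"

definition psl_V :: "(int^2^2) set" where
  "psl_V = psl_T [^]\<^bsub>PSL2Z\<^esub> (-2::int) \<otimes>\<^bsub>PSL2Z\<^esub> psl_S \<otimes>\<^bsub>PSL2Z\<^esub> psl_T [^]\<^bsub>PSL2Z\<^esub> (2::int)"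

definition psl_W :: "(int^2^2) set" where
  "psl_W = psl_S \<otimes>\<^bsub>PSL2Z\<^esub> psl_T [^]\<^bsub>PSL2Z\<^esub> (3::int)"

text \<open>Reduction modulo 48, applied to a coset elementwise.\<close>

definition reduce48 :: "(int^2^2) set \<Rightarrow> (48^2^2) set" where
  "reduce48 C = (\<lambda>A. \<chi> i j. of_int (A $ i $ j)) ` C"

section \<open>The action on Weber triples\<close>

text \<open>The subfield of the complex numbers generated by \<open>z\<close>; it contains the rationals.\<close>

definition Q_adjoin :: "complex \<Rightarrow> complex set" where
  "Q_adjoin z = generate_field ring_of_type_algebra {z}"

text \<open>Taking units of the matrix monoid over \<open>K\<close> forces the inverse to have entries in \<open>K\<close> too.\<close>

definition GL3 :: "complex set \<Rightarrow> (complex^3^3) monoid" where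
  "GL3 K = units_of
     \<lparr>carrier = {A. \<forall>i j. A $ i $ j \<in> K}, monoid.mult = (**), one = mat 1\<rparr>"

definition weber_hom :: "((int^2^2) set \<Rightarrow> complex^3^3) \<Rightarrow> bool" where
  "weber_hom \<iota> \<longleftrightarrow>
     \<iota> \<in> hom PSL2Z (GL3 (Q_adjoin (zeta 24))) \<and>
     \<iota> psl_S = vector [vector [1, 0, 0],
                       vector [0, 0, inverse (zeta 8)],
                       vector [0, zeta 8, 0]] \<and>
     \<iota> psl_T = vector [vector [0, zeta 24, 0],
                       vector [inverse (zeta 24 ^ 2), 0, 0],
                       vector [0, 0, zeta 24]]"

end

theory Submission
  imports Defs "HOL-Number_Theory.Cong"
begin

text \<open>Inversion: expanding logarithms turns \<open>log f\<^sub>1(\<tau>)\<close> and \<open>log f\<^sub>2(\<tau>)\<close> into Lambert series, that is, sums over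
  \<open>k\<close> of \<open>cot(\<pi>k\<tau>)/k\<close> and \<open>cot(\<pi>k\<tau>/2)/k\<close>. By the partial fractions of the cotangent,
  \<open>f\<^sub>1(\<tau>) = f\<^sub>2(-1/\<tau>)\<close> amounts to interchanging the two summations in the double series of
  \<open>(-1)\<^sup>m / (k\<^sup>2\<tau>\<^sup>2 - m\<^sup>2)\<close>. The invariance of \<open>f\<close> then follows from \<open>f f\<^sub>1 f\<^sub>2 = \<surd>2\<close>.

  Congruence property: \<open>\<iota>\<close> is monomial, and \<open>SL\<^sub>2(\<int>)\<close> permutes the three coordinate lines like the
  nonzero vectors of \<open>(\<int>/2)\<^sup>2\<close>. The coefficients are 24th roots of unity given by explicit polynomials in
  the matrix entries modulo 48. These formulas define a homomorphism on \<open>SL\<^sub>2(\<int>/48)\<close>: it suffices to check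
  them under right multiplication by \<open>S\<close> and \<open>T\<close>, which generate this group as well.\<close>

section \<open>The inversion formula for the Weber functions\<close>

text \<open>The obstacle is convergence. For eta itself the double series would carry no sign, and
  the constant term of the cotangent would leave a divergent harmonic series. In the quotients
  behind \<open>weber_f1\<close> and \<open>weber_f2\<close> the sign turns that series into
  \<open>ln 2\<close>, which accounts for the factor \<open>sqrt 2\<close> of
  \<open>weber_f2\<close>; the sums of inverse squares account for the exponents of the leading
  exponentials. For the congruence property, elements of SL2(Z/48) are handled as integer matrices
  with determinant congruent to 1 modulo 48, so one computation with integer polynomials serves Z
  and Z/48 alike. Since 48 = 16 * 3, the exponents can be checked independently modulo 16 and modulo
  3. The resulting representation provides both the factor map and the existence of \<iota>; every
  \<iota> agrees with it because both take the same values at S and T.\<close>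

text \<open>The sign is twice the indicator of an even index minus 1, so the even part is counted
  twice before the whole series is subtracted.\<close>

lemma sums_alternating:
  fixes F :: "nat \<Rightarrow> complex"
  assumes "(\<lambda>k. F (Suc k)) sums s" and "(\<lambda>k. F (2 * Suc k)) sums t"
  shows "(\<lambda>k. (-1) ^ Suc k * F (Suc k)) sums (2 * t - s)"
proof -
  \<comment> \<open>\<open>F (Suc n)\<close> sits at position \<open>n\<close>, so even arguments of
    \<open>F\<close> occupy the odd positions.\<close>
  define g :: "nat \<Rightarrow> nat" where "g k = 2 * k + 1" for k
  have g: "strict_mono g" unfolding g_def by (intro strict_monoI) auto
  have zero: "(if odd n then F (Suc n) else 0) = 0" if "n \<notin> range g" for n
    using that by (auto simp: g_def elim!: oddE)
  have "(\<lambda>k. if odd (g k) then F (Suc (g k)) else 0) sums t"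
    using assms(2) by (simp add: g_def)
  then have "(\<lambda>n. if odd n then F (Suc n) else 0) sums t"
    by (subst (asm) sums_mono_reindex[OF g]) (use zero in auto)
  from sums_diff[OF sums_mult[OF this, of 2] assms(1)]
  show ?thesis
    by (rule sums_cong[THEN iffD1, rotated]) auto
qed

text \<open>In the array of \<open>x ^ (n * k) / k\<close> the rows sum to
  \<open>- Ln (1 - x ^ n)\<close> and the columns are geometric series. Absolute convergence allows
  the exchange, and \<open>exp\<close> turns the sum of logarithms into the product.\<close>

lemma euler_product_exp:
  fixes x :: complex
  assumes "norm x < 1"
  shows "summable (\<lambda>k. x ^ Suc k / (1 - x ^ Suc k) / of_nat (Suc k))"
    and "(\<Prod>k. 1 - x ^ Suc k) = exp (- (\<Sum>k. x ^ Suc k / (1 - x ^ Suc k) / of_nat (Suc k)))"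
proof -
  define r where "r = norm x"
  have r: "0 \<le> r" "r < 1" using assms by (auto simp: r_def)
  have lt: "norm (x ^ Suc n) < 1" for n
    using r power_less_one_iff[of r "Suc n"] by (simp only: norm_power r_def[symmetric]) auto
  define f where "f = (\<lambda>(n, k). (x ^ Suc n) ^ Suc k / of_nat (Suc k))"
  \<comment> \<open>\<open>Suc n * Suc k \<ge> n + k\<close> together with dropping the denominator
    gives a product of two geometric series.\<close>
  have bound: "norm (f p) \<le> r ^ fst p * r ^ snd p" for p
  proof -
    obtain n k where p: "p = (n, k)" by (cases p)
    have "norm (f p) = r ^ (Suc n * Suc k) / real (Suc k)"
      unfolding f_def p by (simp only: prod.case norm_divide norm_power norm_of_nat power_mult r_def)
    also have "\<dots> \<le> r ^ (Suc n * Suc k) / 1"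
      by (intro divide_left_mono) (use r in auto)
    also have "\<dots> \<le> r ^ (n + k)"
      unfolding div_by_1 by (rule power_decreasing) (use r in auto)
    finally show ?thesis by (simp add: p power_add)
  qed
  have geo: "((^) r has_sum (1 / (1 - r))) UNIV"
    by (rule norm_summable_imp_has_sum) (use r geometric_sums[of r] in \<open>auto simp: norm_power\<close>)
  have "(\<lambda>p. r ^ fst p * r ^ snd p) summable_on (UNIV \<times> UNIV)"
  proof (rule summable_on_SigmaI[where g = "\<lambda>n. r ^ n * (1 / (1 - r))"])
    show "((\<lambda>k. r ^ fst (n, k) * r ^ snd (n, k)) has_sum r ^ n * (1 / (1 - r))) UNIV" for n
      using has_sum_cmult_right[OF geo, of "r ^ n"] by simp
    show "(\<lambda>n. r ^ n * (1 / (1 - r))) summable_on UNIV"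
      by (rule summable_on_cmult_left) (rule has_sum_imp_summable[OF geo])
  qed (use r in auto)
  then have "(\<lambda>p. norm (f p)) summable_on (UNIV \<times> UNIV)"
    by (rule Infinite_Sum.abs_summable_on_comparison_test') (rule bound)
  then have "f summable_on (UNIV \<times> UNIV)" by (rule abs_summable_summable)
  then obtain S where S: "(f has_sum S) (UNIV \<times> UNIV)"
    by (auto simp: summable_on_def)
  have row: "((\<lambda>k. f (n, k)) has_sum (- Ln (1 - x ^ Suc n))) UNIV" for n
  proof (rule norm_summable_imp_has_sum)
    have "summable (\<lambda>k. r ^ n * r ^ k)" using r by (intro summable_mult) simp
    then show "summable (\<lambda>k. norm (f (n, k)))"
      by (rule summable_comparison_test') (use bound[of "(n, _)"] in auto)
    from lt[of n] have "norm (- (x ^ Suc n)) < 1" by (simp only: norm_minus_cancel)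
    from sums_minus[OF Ln_series'[OF this]]
    have "(\<lambda>k. (x ^ Suc n) ^ k / of_nat k) sums (- Ln (1 - x ^ Suc n))" by simp
    then have "(\<lambda>k. (x ^ Suc n) ^ Suc k / of_nat (Suc k)) sums (- Ln (1 - x ^ Suc n))"
      using sums_Suc_iff[of "\<lambda>k. (x ^ Suc n) ^ k / of_nat k" "- Ln (1 - x ^ Suc n)"]
      by (simp only: of_nat_0 div_by_0 add_0_right)
    then show "(\<lambda>k. f (n, k)) sums (- Ln (1 - x ^ Suc n))"
      by (simp add: f_def)
  qed
  have col: "((\<lambda>n. f (n, k)) has_sum (x ^ Suc k / (1 - x ^ Suc k) / of_nat (Suc k))) UNIV" for k
  proof (rule norm_summable_imp_has_sum)
    have "summable (\<lambda>n. r ^ k * r ^ n)" using r by (intro summable_mult) simp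
    then show "summable (\<lambda>n. norm (f (n, k)))"
      by (rule summable_comparison_test') (use bound[of "(_, k)"] in \<open>auto simp: mult_ac\<close>)
    have eq: "x ^ Suc k * (x ^ Suc k) ^ n = (x ^ Suc n) ^ Suc k" for n
      by (metis power_Suc power_mult mult.commute)
    from sums_divide[OF sums_mult[OF geometric_sums[OF lt[of k]], of "x ^ Suc k"], of "of_nat (Suc k)"]
    show "(\<lambda>n. f (n, k)) sums (x ^ Suc k / (1 - x ^ Suc k) / of_nat (Suc k))"
      unfolding f_def prod.case eq by simp
  qed
  have "((\<lambda>n. - Ln (1 - x ^ Suc n)) has_sum S) UNIV"
    by (rule has_sum_SigmaD[OF S row])
  then have "(\<lambda>n. - (- Ln (1 - x ^ Suc n))) sums (- S)"
    by (intro sums_minus has_sum_imp_sums)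
  then have log: "(\<lambda>n. Ln (1 - x ^ Suc n)) sums (- S)" by simp
  have "((\<lambda>k. x ^ Suc k / (1 - x ^ Suc k) / of_nat (Suc k)) has_sum S) UNIV"
    by (rule has_sum_SigmaD[OF S[THEN has_sum_swap[THEN iffD1]]]) (use col in auto)
  then have sums: "(\<lambda>k. x ^ Suc k / (1 - x ^ Suc k) / of_nat (Suc k)) sums S"
    by (rule has_sum_imp_sums)
  then show "summable (\<lambda>k. x ^ Suc k / (1 - x ^ Suc k) / of_nat (Suc k))"
    by (rule sums_summable)
  have "exp (Ln (1 - x ^ Suc n)) = 1 - x ^ Suc n" for n
    using lt[of n] by (intro exp_Ln) (auto simp del: power_Suc)
  then show "(\<Prod>k. 1 - x ^ Suc k) = exp (- (\<Sum>k. x ^ Suc k / (1 - x ^ Suc k) / of_nat (Suc k)))"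
    using prodinf_exp[OF sums_summable[OF log]] sums_unique[OF log] sums_unique[OF sums]
    by simp
qed

section \<open>Partial fractions of the cotangent\<close>

lemma divide_square_diff:
  fixes a b :: complex
  assumes "a - b \<noteq> 0" "a + b \<noteq> 0"
  shows "2 * a / (a\<^sup>2 - b\<^sup>2) = inverse (a - b) + inverse (a + b)"
proof -
  have "a\<^sup>2 - b\<^sup>2 = (a - b) * (a + b)" by (simp add: power2_eq_square algebra_simps)
  then show ?thesis unfolding inverse_add[OF assms] by (simp add: divide_inverse)
qed

text \<open>The logarithmic derivative of the reflection formula of \<open>Gamma\<close> expresses
  the cotangent by two values of \<open>Digamma\<close>; in the difference of their limit formulas
  the logarithms cancel.\<close>

lemma cot_partial_fractions:
  fixes z :: complex
  assumes "z \<notin> \<int>"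
  shows "(\<lambda>m. 2 * z / (z\<^sup>2 - (of_nat (Suc m))\<^sup>2)) sums (of_real pi * cot (of_real pi * z) - 1 / z)"
proof -
  have z0: "z \<noteq> 0" "1 - z \<noteq> 0" using assms by auto
  have nonint: "1 - z \<notin> \<int>"
    using assms Ints_diff[of 1 "1 - z"] by auto
  have sin0: "sin (of_real pi * z) \<noteq> 0"
  proof
    assume "sin (of_real pi * z) = 0"
    then obtain n :: int where "of_real pi * z = of_real (real_of_int n * pi)"
      by (auto simp: sin_eq_0)
    then have "of_real pi * z = of_real pi * of_int n" by simp
    then have "z = of_int n" by simp
    with assms show False by auto
  qed
  have np: "z \<notin> \<int>\<^sub>\<le>\<^sub>0" "1 - z \<notin> \<int>\<^sub>\<le>\<^sub>0" using assms nonint nonpos_Ints_Int by blast+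
  have dig: "Digamma (1 - z) - Digamma z = of_real pi * cot (of_real pi * z)"
  proof -
    have "((\<lambda>w. Gamma w * Gamma (1 - w)) has_field_derivative
        Gamma z * Gamma (1 - z) * (Digamma z - Digamma (1 - z))) (at z)"
      using np by (auto intro!: derivative_eq_intros simp: algebra_simps)
    moreover have "((\<lambda>w. of_real pi / sin (of_real pi * w)) has_field_derivative
        - (of_real pi * (cos (of_real pi * z) * of_real pi)) / (sin (of_real pi * z))\<^sup>2) (at z)"
      using sin0 by (auto intro!: derivative_eq_intros simp: power2_eq_square)
    ultimately have "Gamma z * Gamma (1 - z) * (Digamma z - Digamma (1 - z)) =
        - (of_real pi * (cos (of_real pi * z) * of_real pi)) / (sin (of_real pi * z))\<^sup>2"
      unfolding Gamma_reflection_complex by (rule DERIV_unique)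
    also have "\<dots> = Gamma z * Gamma (1 - z) * - (of_real pi * cot (of_real pi * z))"
      unfolding Gamma_reflection_complex cot_def by (simp add: power2_eq_square)
    finally have "Digamma z - Digamma (1 - z) = - (of_real pi * cot (of_real pi * z))"
      using sin0 unfolding Gamma_reflection_complex by (subst (asm) mult_left_cancel) auto
    then show ?thesis by (metis minus_diff_eq minus_minus)
  qed
  have "(\<lambda>m. (of_real (ln (real m)) - (\<Sum>n<m. inverse (1 - z + of_nat n))) -
             (of_real (ln (real m)) - (\<Sum>n<m. inverse (z + of_nat n))))
        \<longlonglongrightarrow> Digamma (1 - z) - Digamma z"
    by (intro tendsto_diff Digamma_LIMSEQ z0)
  then have lim: "(\<lambda>m. (\<Sum>n<m. inverse (z + of_nat n) - inverse (1 - z + of_nat n)))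
        \<longlonglongrightarrow> of_real pi * cot (of_real pi * z)"
    by (simp add: dig sum_subtractf)
  \<comment> \<open>The \<open>Digamma\<close> limits pair the pole at \<open>-n\<close> with the
    one at \<open>n + 1\<close>, the claim pairs \<open>-(n + 1)\<close> with \<open>n + 1\<close>.
    The discrepancy telescopes to \<open>1 / z\<close>.\<close>
  have partial: "inverse (z + of_nat n) - inverse (1 - z + of_nat n) =
      2 * z / (z\<^sup>2 - (of_nat (Suc n))\<^sup>2) + (inverse (z + of_nat n) - inverse (z + of_nat (Suc n)))" for n
  proof -
    have "z \<noteq> of_nat (Suc n)" "z \<noteq> - of_nat (Suc n)"
      using assms by (metis Ints_of_nat, metis Ints_minus Ints_of_nat)
    then have "z - of_nat (Suc n) \<noteq> 0" "z + of_nat (Suc n) \<noteq> 0"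
      by (simp, metis add_eq_0_iff2)
    then have nz: "z - of_nat (Suc n) \<noteq> 0" "z + of_nat (Suc n) \<noteq> 0" by auto
    have "1 - z + of_nat n = - (z - of_nat (Suc n))" by simp
    then have "- inverse (1 - z + of_nat n) = inverse (z - of_nat (Suc n))"
      by (simp only: inverse_minus_eq minus_minus)
    moreover have "2 * z / (z\<^sup>2 - (of_nat (Suc n))\<^sup>2) = inverse (z - of_nat (Suc n)) + inverse (z + of_nat (Suc n))"
      by (rule divide_square_diff[OF nz])
    ultimately show ?thesis by (simp only: diff_conv_add_uminus) (simp add: algebra_simps)
  qed
  have "(\<lambda>m. inverse (z + of_nat m)) \<longlonglongrightarrow> 0"
    by (intro filterlim_compose[OF tendsto_inverse_0] tendsto_add_filterlim_at_infinity[OF tendsto_const] tendsto_of_nat)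
  then have "(\<lambda>m. (\<Sum>n<m. inverse (z + of_nat n) - inverse (1 - z + of_nat n))
        - (inverse z - inverse (z + of_nat m)))
        \<longlonglongrightarrow> of_real pi * cot (of_real pi * z) - (inverse z - 0)"
    by (intro tendsto_diff lim tendsto_const)
  moreover have "(\<Sum>n<m. inverse (z + of_nat n) - inverse (1 - z + of_nat n))
        - (inverse z - inverse (z + of_nat m)) = (\<Sum>n<m. 2 * z / (z\<^sup>2 - (of_nat (Suc n))\<^sup>2))" for m
    unfolding partial sum.distrib using sum_lessThan_telescope'[of "\<lambda>n. inverse (z + of_nat n)" m] by simp
  ultimately show ?thesis
    by (simp add: sums_def divide_inverse)
qed

section \<open>Lambert series and the logarithms of the Weber functions\<close>

definition nome :: "complex \<Rightarrow> complex" where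
  "nome z = exp (2 * of_real pi * \<i> * z)"

text \<open>\<open>lambert \<tau>\<close> is \<open>-log\<close> of the product in the definition of \<^const>\<open>eta\<close>.\<close>

definition lambert :: "complex \<Rightarrow> complex" where
  "lambert \<tau> = (\<Sum>k. nome (of_nat (Suc k) * \<tau>) / (1 - nome (of_nat (Suc k) * \<tau>)) / of_nat (Suc k))"

lemma nome_of_nat_mult: "nome (of_nat k * \<tau>) = nome \<tau> ^ k"
  by (simp add: nome_def exp_of_nat_mult[symmetric] mult_ac)

lemma norm_nome_less_1: "Im \<tau> > 0 \<Longrightarrow> norm (nome \<tau>) < 1"
  by (simp add: nome_def norm_exp_eq_Re)

lemma nome_neq_1: "Im \<tau> > 0 \<Longrightarrow> nome \<tau> \<noteq> 1"
  using norm_nome_less_1[of \<tau>] by auto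

lemma sums_lambert:
  assumes "Im \<tau> > 0"
  shows "(\<lambda>k. nome (of_nat (Suc k) * \<tau>) / (1 - nome (of_nat (Suc k) * \<tau>)) / of_nat (Suc k)) sums lambert \<tau>"
  unfolding lambert_def nome_of_nat_mult
  by (intro summable_sums euler_product_exp norm_nome_less_1 assms)

lemma eta_eq_exp:
  assumes "Im \<tau> > 0"
  shows "eta \<tau> = exp (of_real pi * \<i> * \<tau> / 12 - lambert \<tau>)"
proof -
  have "exp (2 * of_real pi * \<i> * of_nat (Suc k) * \<tau>) = nome (of_nat (Suc k) * \<tau>)" for k
    by (simp only: nome_def mult_ac)
  then have "exp (2 * of_real pi * \<i> * of_nat (Suc k) * \<tau>) = nome \<tau> ^ Suc k" for k
    by (simp only: nome_of_nat_mult)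
  then have "(\<Prod>k. 1 - exp (2 * of_real pi * \<i> * of_nat (Suc k) * \<tau>)) = exp (- lambert \<tau>)"
    using euler_product_exp(2)[OF norm_nome_less_1[OF assms]]
    by (simp only: lambert_def nome_of_nat_mult)
  then show ?thesis
    unfolding eta_def by (simp only: exp_add[symmetric]) (simp add: mult_ac)
qed

text \<open>The term of \<tau> at index \<open>2 * k\<close> is half the term of
  \<open>2 * \<tau>\<close> at \<open>k\<close>, because of the denominator; the doubling in
  \<open>sums_alternating\<close> cancels this half.\<close>

lemma alternating_sums_lambert:
  assumes "Im \<tau> > 0"
  shows "(\<lambda>k. (-1) ^ Suc k * (nome (of_nat (Suc k) * \<tau>) / (1 - nome (of_nat (Suc k) * \<tau>)) / of_nat (Suc k)))
    sums (lambert (2 * \<tau>) - lambert \<tau>)"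
proof -
  have "K (of_nat (2 * Suc k) * \<tau>) / of_nat (2 * Suc k) = K (of_nat (Suc k) * (2 * \<tau>)) / of_nat (Suc k) / 2"
    for k and K :: "complex \<Rightarrow> complex"
  proof -
    have "of_nat (2 * Suc k) * \<tau> = of_nat (Suc k) * (2 * \<tau>)" by simp
    then show ?thesis by (metis divide_divide_eq_left mult.commute of_nat_mult of_nat_numeral)
  qed
  note eq = this[of "\<lambda>z. nome z / (1 - nome z)"]
  have "(\<lambda>k. nome (of_nat (2 * Suc k) * \<tau>) / (1 - nome (of_nat (2 * Suc k) * \<tau>)) / of_nat (2 * Suc k))
      sums (lambert (2 * \<tau>) / 2)"
    by (subst eq) (intro sums_divide sums_lambert, use assms in simp)
  from sums_alternating[where F = "\<lambda>k. nome (of_nat k * \<tau>) / (1 - nome (of_nat k * \<tau>)) / of_nat k",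
      OF sums_lambert[OF assms] this]
  show ?thesis by simp
qed

text \<open>This is the logarithm of \<open>weber_product\<close> without its elementary factors,
  and it holds termwise. For odd n the nomes at the two half arguments are w and -w, and
  \<open>w / (1 - w) - w / (1 + w) = 2 * w^2 / (1 - w^2)\<close>; for even n the two arguments
  differ by an integer.\<close>

lemma lambert_half_sum:
  assumes "Im \<tau> > 0"
  shows "lambert ((\<tau> + 1) / 2) + lambert (\<tau> / 2) + lambert (2 * \<tau>) = 3 * lambert \<tau>"
proof -
  define K where "K z = nome z / (1 - nome z)" for z
  have Im: "Im ((\<tau> + 1) / 2) > 0" "Im (\<tau> / 2) > 0" using assms by auto
  have nome_shift: "nome (z + of_nat m) = nome z" for z m
  proof -
    have "exp (2 * of_real pi * \<i> * of_nat m :: complex) = 1"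
      using exp_of_nat_mult[of m "2 * of_real pi * \<i> :: complex"] by (simp add: mult_ac)
    then show ?thesis by (simp add: nome_def distrib_left exp_add)
  qed
  have nome_half: "nome (z + 1 / 2) = - nome z" for z
    by (simp add: nome_def distrib_left exp_add)
  \<comment> \<open>One expression for both parities: at odd n the sign doubles the term of \<tau>,
    at even n it cancels that term and leaves the one of index \<open>n div 2\<close>. Each of the
    three summands belongs to a series already summed.\<close>
  have split: "K (of_nat n * ((\<tau> + 1) / 2)) / of_nat n + K (of_nat n * (\<tau> / 2)) / of_nat n =
      K (of_nat n * \<tau>) / of_nat n - (-1) ^ n * (K (of_nat n * \<tau>) / of_nat n)
      + (if even n then K (of_nat (n div 2) * \<tau>) / of_nat (n div 2) else 0)" if "n > 0" for n
  proof (cases "even n")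
    case True
    then obtain m where m: "n = 2 * m" by auto
    have "of_nat n * ((\<tau> + 1) / 2) = of_nat m * \<tau> + of_nat m" by (simp add: m field_simps)
    then have "K (of_nat n * ((\<tau> + 1) / 2)) = K (of_nat m * \<tau>)" by (simp add: K_def nome_shift)
    then show ?thesis using that by (simp add: m field_simps)
  next
    case False
    then obtain m where m: "n = 2 * m + 1" by (auto elim: oddE)
    define w where "w = nome (of_nat n * (\<tau> / 2))"
    have "of_nat n * ((\<tau> + 1) / 2) = of_nat n * (\<tau> / 2) + 1 / 2 + of_nat m" by (simp add: m field_simps)
    then have 1: "nome (of_nat n * ((\<tau> + 1) / 2)) = - w" by (simp only: nome_shift nome_half w_def)
    have "w * w = nome (of_nat n * \<tau>)"
      unfolding w_def nome_def exp_add[symmetric] by (simp add: field_simps)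
    then have 2: "nome (of_nat n * \<tau>) = w * w" by simp
    have "norm w < 1" unfolding w_def by (rule norm_nome_less_1) (use assms that in simp)
    then have "1 - w \<noteq> 0" "1 + w \<noteq> 0" by (auto simp: add_eq_0_iff)
    moreover have "1 - w * w = (1 - w) * (1 + w)" by (simp add: algebra_simps)
    ultimately have "- w / (1 + w) + w / (1 - w) = 2 * (w * w / (1 - w * w))"
      by (simp add: divide_simps) (simp add: algebra_simps)
    then have "K (of_nat n * ((\<tau> + 1) / 2)) + K (of_nat n * (\<tau> / 2)) = 2 * K (of_nat n * \<tau>)"
      unfolding K_def 1 2 w_def[symmetric] by simp
    then have "K (of_nat n * ((\<tau> + 1) / 2)) / of_nat n + K (of_nat n * (\<tau> / 2)) / of_nat n
        = 2 * K (of_nat n * \<tau>) / of_nat n"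
      by (simp only: add_divide_distrib[symmetric])
    then show ?thesis using False by simp
  qed
  have lam: "(\<lambda>k. K (of_nat (Suc k) * t) / of_nat (Suc k)) sums lambert t" if "Im t > 0" for t
    using sums_lambert[OF that] by (simp only: K_def)
  have alt: "(\<lambda>k. (-1) ^ Suc k * (K (of_nat (Suc k) * \<tau>) / of_nat (Suc k))) sums (lambert (2 * \<tau>) - lambert \<tau>)"
    using alternating_sums_lambert[OF assms] by (simp only: K_def)
  have ev: "(\<lambda>k. if even (Suc k) then K (of_nat (Suc k div 2) * \<tau>) / of_nat (Suc k div 2) else 0) sums lambert \<tau>"
  proof -
    define g :: "nat \<Rightarrow> nat" where "g k = 2 * k + 1" for k
    have g: "strict_mono g" unfolding g_def by (intro strict_monoI) auto
    have zero: "(if even (Suc n) then K (of_nat (Suc n div 2) * \<tau>) / of_nat (Suc n div 2) else 0) = 0"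
      if "n \<notin> range g" for n
      using that by (auto simp: g_def elim!: oddE)
    have "(\<lambda>k. if even (Suc (g k)) then K (of_nat (Suc (g k) div 2) * \<tau>) / of_nat (Suc (g k) div 2) else 0) sums lambert \<tau>"
      using lam[OF assms] by (simp add: g_def)
    then show ?thesis
      by (subst (asm) sums_mono_reindex[OF g]) (use zero in auto)
  qed
  have "(\<lambda>k. K (of_nat (Suc k) * ((\<tau> + 1) / 2)) / of_nat (Suc k) + K (of_nat (Suc k) * (\<tau> / 2)) / of_nat (Suc k))
     sums (lambert ((\<tau> + 1) / 2) + lambert (\<tau> / 2))"
    by (intro sums_add lam Im)
  moreover have "(\<lambda>k. K (of_nat (Suc k) * ((\<tau> + 1) / 2)) / of_nat (Suc k) + K (of_nat (Suc k) * (\<tau> / 2)) / of_nat (Suc k))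
     sums (lambert \<tau> - (lambert (2 * \<tau>) - lambert \<tau>) + lambert \<tau>)"
    using sums_add[OF sums_diff[OF lam[OF assms] alt] ev] by (simp only: split[OF zero_less_Suc])
  ultimately have "lambert ((\<tau> + 1) / 2) + lambert (\<tau> / 2) = lambert \<tau> - (lambert (2 * \<tau>) - lambert \<tau>) + lambert \<tau>"
    by (rule sums_unique2)
  then show ?thesis by simp
qed

lemma weber_f1_eq_exp:
  assumes "Im \<tau> > 0"
  shows "weber_f1 \<tau> = exp (- of_real pi * \<i> * \<tau> / 24 - (lambert (\<tau> / 2) - lambert \<tau>))"
  using assms by (simp add: weber_f1_def eta_eq_exp exp_diff[symmetric] algebra_simps)

lemma weber_f2_eq_exp:
  assumes "Im \<tau> > 0"
  shows "weber_f2 \<tau> = exp (of_real (ln 2) / 2 + of_real pi * \<i> * \<tau> / 12 - (lambert (2 * \<tau>) - lambert \<tau>))"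
proof -
  have "complex_of_real (sqrt 2) = exp (of_real (ln 2 / 2))"
    unfolding exp_of_real by (simp add: ln_sqrt[symmetric])
  with assms show ?thesis
    by (simp add: weber_f2_def eta_eq_exp exp_diff[symmetric] exp_add[symmetric] algebra_simps)
qed

lemma weber_f_eq_exp:
  assumes "Im \<tau> > 0"
  shows "weber_f \<tau> = exp (- of_real pi * \<i> * \<tau> / 24 - (lambert ((\<tau> + 1) / 2) - lambert \<tau>))"
proof -
  have "inverse (zeta 48) = exp (- (of_real pi * \<i> / 24))"
    by (simp add: zeta_def exp_minus mult_ac)
  with assms have "weber_f \<tau> = exp (- (of_real pi * \<i> / 24) +
      ((of_real pi * \<i> * ((\<tau> + 1) / 2) / 12 - lambert ((\<tau> + 1) / 2)) - (of_real pi * \<i> * \<tau> / 12 - lambert \<tau>)))"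
    unfolding weber_f_def exp_add exp_diff[of "_ - _" "_ - _"] by (simp add: eta_eq_exp)
  also have "\<dots> = exp (- of_real pi * \<i> * \<tau> / 24 - (lambert ((\<tau> + 1) / 2) - lambert \<tau>))"
    by (intro arg_cong[where f = exp])
      (simp add: distrib_left distrib_right add_divide_distrib diff_divide_distrib)
  finally show ?thesis .
qed

text \<open>The linear exponents cancel, as -1/24 - 1/24 + 1/12 = 0, and
  \<open>lambert_half_sum\<close> removes the Lambert values.\<close>

lemma weber_product:
  assumes "Im \<tau> > 0"
  shows "weber_f \<tau> * weber_f1 \<tau> * weber_f2 \<tau> = of_real (sqrt 2)"
proof -
  have "lambert ((\<tau> + 1) / 2) = 3 * lambert \<tau> - lambert (\<tau> / 2) - lambert (2 * \<tau>)"
    using lambert_half_sum[OF assms] by (simp add: algebra_simps)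
  then have "weber_f \<tau> * weber_f1 \<tau> * weber_f2 \<tau> = exp (of_real (ln 2 / 2))"
    unfolding weber_f_eq_exp[OF assms] weber_f1_eq_exp[OF assms] weber_f2_eq_exp[OF assms] exp_add[symmetric]
    by simp
  also have "\<dots> = of_real (sqrt 2)"
    unfolding exp_of_real by (simp add: ln_sqrt[symmetric])
  finally show ?thesis .
qed

section \<open>Interchange of summations and the inversion of the Weber functions\<close>

text \<open>Only conditionally convergent double series occur below. Grouping the alternating index in
  pairs makes them absolutely convergent, which is what the bound expresses.\<close>

lemma alternating_double_sums_swap:
  fixes a :: "nat \<Rightarrow> nat \<Rightarrow> complex"
  assumes bound: "\<And>k j. norm (a k (2 * j + 1) - a k (2 * j)) \<le>
      C * (real (Suc k) powr (-3/2) * real (Suc j) powr (-3/2))"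
    and rows: "\<And>k. (\<lambda>m. (-1) ^ Suc m * a k m) sums R k"
    and cols: "\<And>m. (\<lambda>k. a k m) sums A m"
    and R: "R sums Z"
    and A: "(\<lambda>m. (-1) ^ Suc m * A m) sums Y"
  shows "Z = Y"
proof -
  \<comment> \<open>Truncations of even length keep the pairs together. The limits exist by
    \<open>rows\<close> and \<open>A\<close>, so this subsequence determines them.\<close>
  define s where "s k n = (\<Sum>m<2 * n. (-1) ^ Suc m * a k m)" for k n
  define p where "p n = real (Suc n) powr (-3/2)" for n
  have s_eq: "s k n = (\<Sum>j<n. a k (2 * j + 1) - a k (2 * j))" for k n
    unfolding s_def by (induction n) auto
  have p: "summable p" "\<And>n. p n \<ge> 0"
    unfolding p_def by (subst summable_Suc_iff[of "\<lambda>n. real n powr (-3/2)"]) (auto simp: summable_real_powr_iff)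
  have C: "C \<ge> 0" using order_trans[OF norm_ge_zero bound[of 0 0]] by simp
  have s_bound: "norm (s k n) \<le> C * suminf p * p k" for k n
  proof -
    have "norm (s k n) \<le> (\<Sum>j<n. C * (p k * p j))"
      unfolding s_eq p_def by (rule sum_norm_le) (rule bound)
    also have "\<dots> = C * p k * (\<Sum>j<n. p j)" by (simp add: sum_distrib_left mult_ac)
    also have "\<dots> \<le> C * p k * suminf p"
      by (intro mult_left_mono sum_le_suminf) (use p C in auto)
    finally show ?thesis by (simp add: mult_ac)
  qed
  \<comment> \<open>Dominated convergence for series: \<open>s_bound\<close> is uniform in
    \<open>n\<close> and summable in \<open>k\<close>.\<close>
  have "(\<lambda>n. \<Sum>k. s k n) \<longlonglongrightarrow> suminf R"
  proof (rule tannerys_theorem[THEN conjunct2, THEN conjunct2])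
    show "(\<lambda>n. s k n) \<longlonglongrightarrow> R k" for k
      using rows[of k] unfolding sums_def s_def
      by (rule filterlim_compose) (auto intro: mult_nat_left_at_top)
    show "\<forall>\<^sub>F (k, n) in sequentially \<times>\<^sub>F sequentially. norm (s k n) \<le> C * suminf p * p k"
      using s_bound by (intro always_eventually) auto
    show "summable (\<lambda>k. C * suminf p * p k)" by (intro summable_mult p)
  qed auto
  moreover have "(\<Sum>k. s k n) = (\<Sum>m<2 * n. (-1) ^ Suc m * A m)" for n
    unfolding s_def by (intro sums_unique[symmetric] sums_sum sums_mult cols)
  moreover have "(\<lambda>n. \<Sum>m<2 * n. (-1) ^ Suc m * A m) \<longlonglongrightarrow> Y"
    using A unfolding sums_def by (rule filterlim_compose) (auto intro: mult_nat_left_at_top)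
  ultimately have "suminf R = Y" by (metis (no_types, lifting) LIMSEQ_unique ext)
  then show ?thesis using R by (simp add: sums_iff)
qed

text \<open>With indices counted from 1, the numerator of the difference is of order j, while both
  denominators are at least a constant times the square of \<open>max k j\<close>. The quotient
  \<open>j / max k j ^ 4\<close> is dominated by a product of summable powers.\<close>

lemma lattice_difference_bound:
  fixes \<tau> :: complex
  assumes "Im \<tau> > 0"
  obtains C where "\<And>k j :: nat. norm (1 / ((of_nat (Suc k))\<^sup>2 * \<tau>\<^sup>2 - (of_nat (Suc (2 * j + 1)))\<^sup>2)
      - 1 / ((of_nat (Suc k))\<^sup>2 * \<tau>\<^sup>2 - (of_nat (Suc (2 * j)))\<^sup>2))
      \<le> C * (real (Suc k) powr (-3/2) * real (Suc j) powr (-3/2))"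
proof -
  \<comment> \<open>The two entries come from the estimates \<open>N \<ge> k * Im \<tau>\<close> and
    \<open>\<bar>m\<bar> \<le> N * (1 + norm \<tau> / Im \<tau>)\<close> for the norm
    \<open>N\<close> of \<open>k * \<tau> + m\<close>.\<close>
  define \<delta> where "\<delta> = min (Im \<tau>) (1 / (1 + norm \<tau> / Im \<tau>))"
  define c where "c = 1 + norm \<tau> / Im \<tau>"
  have c: "c > 0" unfolding c_def using assms by (intro add_pos_nonneg) auto
  have \<delta>: "\<delta> > 0" "\<delta> \<le> Im \<tau>" using assms c by (auto simp: \<delta>_def simp flip: c_def)
  have "\<delta> \<le> 1 / c" by (simp add: \<delta>_def c_def)
  then have \<delta>c: "\<delta> * c \<le> 1" using c by (simp add: pos_le_divide_eq)
  have lin: "\<delta> * max k \<bar>m\<bar> \<le> norm (of_real k * \<tau> + of_real m)" if "k > 0" for k m :: real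
  proof -
    define N where "N = norm (of_real k * \<tau> + of_real m)"
    have "k * Im \<tau> \<le> N"
      using abs_Im_le_cmod[of "of_real k * \<tau> + of_real m"] by (simp add: N_def)
    then have k: "k \<le> N / Im \<tau>" using assms by (simp add: field_simps)
    have "\<bar>m\<bar> = norm ((of_real k * \<tau> + of_real m) - of_real k * \<tau>)" by simp
    also have "\<dots> \<le> N + k * norm \<tau>"
      unfolding N_def using norm_triangle_ineq4[of "of_real k * \<tau> + of_real m" "of_real k * \<tau>"] that
      by (simp add: norm_mult)
    also have "\<dots> \<le> N + N / Im \<tau> * norm \<tau>" using k by (intro add_left_mono mult_right_mono) auto
    also have "\<dots> = N * c" by (simp add: c_def distrib_left)
    finally have "\<delta> * \<bar>m\<bar> \<le> \<delta> * (N * c)"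
      using \<delta>(1) by (intro mult_left_mono) auto
    also have "\<dots> = N * (\<delta> * c)" by simp
    also have "\<dots> \<le> N" using \<delta>c by (intro mult_left_le) (auto simp: N_def)
    finally have "\<delta> * \<bar>m\<bar> \<le> N" .
    moreover have "\<delta> * k \<le> N"
    proof -
      have "k * \<delta> \<le> k * Im \<tau>" using \<delta>(2) that by (intro mult_left_mono) auto
      then show ?thesis using \<open>k * Im \<tau> \<le> N\<close> by (simp add: mult.commute)
    qed
    ultimately show ?thesis by (auto simp: max_def N_def)
  qed
  have quad: "\<delta>\<^sup>2 * Z\<^sup>2 \<le> norm (of_real (k\<^sup>2) * \<tau>\<^sup>2 - of_real (m\<^sup>2))"
    if "k > 0" "0 \<le> Z" "Z \<le> max k \<bar>m\<bar>" for k m Z :: real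
  proof -
    have "\<delta>\<^sup>2 * Z\<^sup>2 = (\<delta> * Z) * (\<delta> * Z)" by (simp add: power2_eq_square mult_ac)
    also have "\<dots> \<le> (\<delta> * max k \<bar>m\<bar>) * (\<delta> * max k \<bar>m\<bar>)"
      using \<delta>(1) that by (intro mult_mono mult_left_mono mult_nonneg_nonneg) auto
    also have "\<dots> \<le> norm (of_real k * \<tau> + of_real m) * norm (of_real k * \<tau> + of_real (- m))"
      using lin[OF that(1), of m] lin[OF that(1), of "-m"] \<delta>(1) that(1)
      by (intro mult_mono) (auto simp: le_max_iff_disj)
    also have "\<dots> = norm (of_real (k\<^sup>2) * \<tau>\<^sup>2 - of_real (m\<^sup>2))"
      unfolding norm_mult[symmetric] by (rule arg_cong[where f = norm]) (simp add: power2_eq_square algebra_simps)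
    finally show ?thesis .
  qed
  have "norm (1 / ((of_nat (Suc k))\<^sup>2 * \<tau>\<^sup>2 - (of_nat (Suc (2 * j + 1)))\<^sup>2)
      - 1 / ((of_nat (Suc k))\<^sup>2 * \<tau>\<^sup>2 - (of_nat (Suc (2 * j)))\<^sup>2))
      \<le> 4 / \<delta> ^ 4 * (real (Suc k) powr (-3/2) * real (Suc j) powr (-3/2))" for k j :: nat
  proof -
    define K where "K = real (Suc k)"
    define J where "J = real (Suc j)"
    define Z where "Z = max K J"
    define P where "P = of_real (K\<^sup>2) * \<tau>\<^sup>2 - of_real ((2 * J)\<^sup>2)"
    define Q where "Q = of_real (K\<^sup>2) * \<tau>\<^sup>2 - of_real ((2 * J - 1)\<^sup>2)"
    have pos: "K \<ge> 1" "J \<ge> 1" "Z \<ge> K" "Z \<ge> J" by (auto simp: K_def J_def Z_def)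
    have PQ: "\<delta>\<^sup>2 * Z\<^sup>2 \<le> norm P" "\<delta>\<^sup>2 * Z\<^sup>2 \<le> norm Q"
      unfolding P_def Q_def by (rule quad; use pos in \<open>auto simp: Z_def\<close>)+
    have dX: "\<delta>\<^sup>2 * Z\<^sup>2 > 0" using \<delta> pos by simp
    then have nz: "P \<noteq> 0" "Q \<noteq> 0" using PQ by auto
    have "1 / P - 1 / Q = (Q - P) / (P * Q)" using nz by (simp add: field_simps)
    also have "Q - P = of_real (4 * J - 1)"
      by (simp add: P_def Q_def power2_eq_square algebra_simps)
    finally have "norm (1 / P - 1 / Q) = \<bar>4 * J - 1\<bar> / (norm P * norm Q)"
      by (simp only: norm_divide norm_mult norm_of_real)
    also have "\<dots> \<le> 4 * J / ((\<delta>\<^sup>2 * Z\<^sup>2) * (\<delta>\<^sup>2 * Z\<^sup>2))"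
      using pos PQ dX by (intro frac_le mult_mono mult_pos_pos) auto
    also have "\<dots> = 4 / \<delta> ^ 4 * (J / Z ^ 4)" by (simp add: power2_eq_square power4_eq_xxxx)
    \<comment> \<open>The exponent 4 is split as 3/2 + 5/2, so that after cancelling one factor
      \<open>J\<close> both variables keep the summable exponent -3/2.\<close>
    also have "J / Z ^ 4 \<le> K powr (-3/2) * J powr (-3/2)"
    proof -
      have "K powr (3/2) * J powr (5/2) \<le> Z powr (3/2) * Z powr (5/2)"
        using pos by (intro mult_mono powr_mono2) auto
      also have "\<dots> = Z ^ 4" using pos by (simp add: powr_add[symmetric] powr_numeral)
      finally have "J / Z ^ 4 \<le> J / (K powr (3/2) * J powr (5/2))"
        using pos by (intro divide_left_mono mult_pos_pos) auto
      also have "\<dots> = K powr (-3/2) * J powr (-3/2)"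
      proof -
        have "J powr (5/2) = J * J powr (3/2)"
          using pos powr_add[of J 1 "3/2"] by simp
        then show ?thesis using pos by (simp add: powr_minus field_simps)
      qed
      finally show ?thesis .
    qed
    finally have "norm (1 / P - 1 / Q) \<le> 4 / \<delta> ^ 4 * (K powr (-3/2) * J powr (-3/2))"
      using \<delta> by (simp add: divide_right_mono)
    moreover have "P = (of_nat (Suc k))\<^sup>2 * \<tau>\<^sup>2 - (of_nat (Suc (2 * j + 1)))\<^sup>2"
      "Q = (of_nat (Suc k))\<^sup>2 * \<tau>\<^sup>2 - (of_nat (Suc (2 * j)))\<^sup>2"
      by (simp_all add: P_def Q_def K_def J_def algebra_simps)
    ultimately show ?thesis by (simp only: K_def J_def)
  qed
  then show ?thesis by (rule that)
qed

text \<open>The constant \<open>- \<i>\<close> is the limit of the cotangent for growing imaginary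
  part; what remains is a Lambert term.\<close>

lemma cot_eq_nome:
  assumes "Im z > 0"
  shows "cot (of_real pi * z) = - \<i> - 2 * \<i> * (nome z / (1 - nome z))"
proof -
  define e where "e = exp (\<i> * (of_real pi * z))"
  have e: "e \<noteq> 0" "nome z = e * e"
    by (simp_all add: e_def nome_def exp_add[symmetric] field_simps)
  have "1 - e * e \<noteq> 0" using nome_neq_1[OF assms] e by auto
  moreover have "exp (- (\<i> * (of_real pi * z))) = 1 / e" by (simp add: e_def exp_minus divide_inverse)
  ultimately have "cot (of_real pi * z) = (e + 1 / e) / 2 / ((e - 1 / e) / (2 * \<i>))"
    unfolding cot_def sin_exp_eq cos_exp_eq e_def by simp
  moreover have "e + 1 / e = (1 + e * e) / e" "e - 1 / e = - ((1 - e * e) / e)"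
    using e by (simp_all add: add_divide_distrib diff_divide_distrib)
  ultimately have "cot (of_real pi * z) = (1 + e * e) / e / 2 / (- ((1 - e * e) / e) / (2 * \<i>))"
    by (simp only:)
  also have "a / e / 2 / (- (b / e) / (2 * \<i>)) = - \<i> * (a / b)" for a b
    using e by (cases "b = 0") (simp_all add: field_simps)
  also have "(1 + e * e) / (1 - e * e) = 1 + 2 * (e * e / (1 - e * e))"
    using \<open>1 - e * e \<noteq> 0\<close> by (simp add: divide_simps)
  finally show ?thesis unfolding e by (simp add: algebra_simps)
qed

lemma not_Ints_if_Im_pos: "Im z > 0 \<Longrightarrow> z \<notin> \<int>"
  by (auto elim!: Ints_cases)

text \<open>The algebra that ends the inversion proof: \<open>p\<close> is pi, \<open>t\<close> is
  \<tau>, \<open>l\<close> is \<open>ln 2\<close>, and \<open>L\<close>, \<open>M\<close> are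
  differences of Lambert values at \<tau> and at \<open>-1 / \<tau>\<close>. The numbers
  \<open>p^2 / 6\<close> and \<open>- p^2 / 12\<close> are the plain and the alternating sum of
  inverse squares.\<close>

lemma solve_lambert_equation:
  fixes p t L M l :: complex
  assumes nz: "p \<noteq> 0" "t \<noteq> 0"
    and eq: "(- p * \<i> / t) * L - 1 / (2 * t\<^sup>2) * (p\<^sup>2 / 6) =
      (- p * \<i> / (2 * t)) * (- l) - (p * \<i> / t) * M + (1 / 2) * (- (p\<^sup>2 / 12))"
  shows "L = p * \<i> / (12 * t) - l / 2 + M - p * \<i> * t / 24"
proof -
  have "24 * t\<^sup>2 * ((- p * \<i> / t) * L - 1 / (2 * t\<^sup>2) * (p\<^sup>2 / 6)) = - p * (24 * \<i> * t * L) - p * (2 * p)"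
    using nz by (simp add: power2_eq_square right_diff_distrib)
  moreover have "24 * t\<^sup>2 * ((- p * \<i> / (2 * t)) * (- l) - (p * \<i> / t) * M + (1 / 2) * (- (p\<^sup>2 / 12))) =
      p * (12 * \<i> * t * l) - p * (24 * \<i> * t * M) - p * (p * t\<^sup>2)"
    using nz by (simp add: power2_eq_square algebra_simps)
  ultimately have "p * (- (24 * \<i> * t * L) - 2 * p) = p * (12 * \<i> * t * l - 24 * \<i> * t * M - p * t\<^sup>2)"
    using arg_cong[OF eq, of "\<lambda>x. 24 * t\<^sup>2 * x"] by (simp only: right_diff_distrib mult_minus_left mult_minus_right)
  then have "- (24 * \<i> * t * L) - 2 * p = 12 * \<i> * t * l - 24 * \<i> * t * M - p * t\<^sup>2"
    using nz mult_cancel_left by blast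
  then have "\<i> * (- (24 * \<i> * t * L) - 2 * p) = \<i> * (12 * \<i> * t * l - 24 * \<i> * t * M - p * t\<^sup>2)"
    by (rule arg_cong)
  then have "24 * t * L = 2 * \<i> * p - 12 * t * l + 24 * t * M - \<i> * p * t\<^sup>2"
    by (simp add: algebra_simps)
  then have "L = (2 * \<i> * p - 12 * t * l + 24 * t * M - \<i> * p * t\<^sup>2) / (24 * t)"
    using nz by (simp add: eq_divide_eq mult_ac)
  also have "\<dots> = p * \<i> / (12 * t) - l / 2 + M - p * \<i> * t / 24"
    using nz by (simp add: diff_divide_distrib add_divide_distrib power2_eq_square mult_ac)
  finally show ?thesis .
qed

text \<open>For fixed \<open>k\<close> the array \<open>a\<close> is a partial fraction series at a
  multiple of \<tau>, for fixed \<open>m\<close> one at a multiple of \<sigma>. The sign depends on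
  \<open>m\<close> only: summed inside the rows it produces the arguments \<open>\<tau> / 2\<close>
  and \<tau> of \<open>weber_f1\<close>, summed over the columns the arguments
  \<open>2 * \<sigma>\<close> and \<sigma> of \<open>weber_f2\<close>.\<close>

lemma weber_f1_eq_weber_f2_inversion:
  assumes "Im \<tau> > 0"
  shows "weber_f1 \<tau> = weber_f2 (-1 / \<tau>)"
proof -
  define \<sigma> where "\<sigma> = -1 / \<tau>"
  have \<sigma>: "Im \<sigma> > 0"
    using assms by (simp add: \<sigma>_def Im_divide power2_eq_square field_simps add_pos_nonneg)
  have \<tau>0: "\<tau> \<noteq> 0" using assms by auto
  define K where "K z = nome z / (1 - nome z)" for z
  define a where "a k m = 1 / ((of_nat (Suc k))\<^sup>2 * \<tau>\<^sup>2 - (of_nat (Suc m))\<^sup>2)" for k m :: nat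
  define R where "R k = (- of_real pi * \<i> / \<tau>) * (K (of_nat (Suc k) * (\<tau> / 2)) / of_nat (Suc k)
      - K (of_nat (Suc k) * \<tau>) / of_nat (Suc k)) - 1 / (2 * \<tau>\<^sup>2) * (1 / of_nat ((k + 1)\<^sup>2))" for k
  define A where "A m = (- of_real pi * \<i> / (2 * \<tau>)) * (1 / of_nat (Suc m))
      - (of_real pi * \<i> / \<tau>) * (K (of_nat (Suc m) * \<sigma>) / of_nat (Suc m)) + (1 / 2) * (1 / of_nat ((m + 1)\<^sup>2))" for m
  have pfd: "(\<lambda>m. 2 * z / (z\<^sup>2 - (of_nat (Suc m))\<^sup>2)) sums (- of_real pi * \<i> - 2 * of_real pi * \<i> * K z - 1 / z)"
    if "Im z > 0" for z
  proof -
    have "of_real pi * cot (of_real pi * z) - 1 / z = - of_real pi * \<i> - 2 * of_real pi * \<i> * K z - 1 / z"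
      unfolding cot_eq_nome[OF that] K_def by (simp add: right_diff_distrib)
    with cot_partial_fractions[OF not_Ints_if_Im_pos[OF that]] show ?thesis by (simp only:)
  qed
  have lam: "(\<lambda>k. K (of_nat (Suc k) * t) / of_nat (Suc k)) sums lambert t" if "Im t > 0" for t
    using sums_lambert[OF that] by (simp only: K_def)
  have rows: "(\<lambda>m. (-1) ^ Suc m * a k m) sums R k" for k
  proof -
    define n where "n = complex_of_nat (Suc k)"
    have n0: "n \<noteq> 0" unfolding n_def by (simp del: of_nat_Suc)
    define z where "z = n * \<tau>"
    have z: "Im z > 0" using assms by (simp add: z_def n_def)
    have z0: "z \<noteq> 0" using z by auto
    \<comment> \<open>The terms of even index at \<open>z\<close> form half the series at
      \<open>z / 2\<close>; in \<open>sums_alternating\<close> the constant term of the cotangent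
      then cancels.\<close>
    have "2 * z / (z\<^sup>2 - (of_nat (2 * Suc m))\<^sup>2) = 2 * (z / 2) / ((z / 2)\<^sup>2 - (of_nat (Suc m))\<^sup>2) / 2" for m
    proof -
      have "z\<^sup>2 - (of_nat (2 * Suc m))\<^sup>2 = 4 * ((z / 2)\<^sup>2 - (of_nat (Suc m))\<^sup>2)"
        by (simp add: power2_eq_square algebra_simps)
      moreover have "2 * z / (4 * D) = 2 * (z / 2) / D / 2" for D by simp
      ultimately show ?thesis by (simp only:)
    qed
    with sums_divide[OF pfd[of "z / 2"], of 2] z
    have "(\<lambda>m. 2 * z / (z\<^sup>2 - (of_nat (2 * Suc m))\<^sup>2)) sums
        ((- of_real pi * \<i> - 2 * of_real pi * \<i> * K (z / 2) - 1 / (z / 2)) / 2)"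
      by (simp del: of_nat_Suc)
    from sums_alternating[where F = "\<lambda>m. 2 * z / (z\<^sup>2 - (of_nat m)\<^sup>2)", OF pfd[OF z] this]
    have "(\<lambda>m. (-1) ^ Suc m * (2 * z / (z\<^sup>2 - (of_nat (Suc m))\<^sup>2))) sums
        (- 2 * of_real pi * \<i> * (K (z / 2) - K z) - 1 / z)"
      by (rule back_subst[of "(sums) _"]) (simp add: algebra_simps diff_divide_distrib add_divide_distrib)
    from sums_divide[OF this, of "2 * z"]
    have "(\<lambda>m. (-1) ^ Suc m * (1 / (z\<^sup>2 - (of_nat (Suc m))\<^sup>2))) sums
        ((- 2 * of_real pi * \<i> * (K (z / 2) - K z) - 1 / z) / (2 * z))"
      using z0 by simp
    moreover have "z\<^sup>2 = (of_nat (Suc k))\<^sup>2 * \<tau>\<^sup>2" by (simp add: z_def n_def power_mult_distrib)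
    moreover have "(- 2 * of_real pi * \<i> * (K (z / 2) - K z) - 1 / z) / (2 * z) = R k"
    proof -
      have "complex_of_nat ((k + 1)\<^sup>2) = n\<^sup>2" by (simp add: n_def)
      then have "R k = (- of_real pi * \<i> / \<tau>) * (K (z / 2) / n - K z / n) - 1 / (2 * \<tau>\<^sup>2) * (1 / n\<^sup>2)"
        by (simp only: R_def n_def[symmetric] z_def times_divide_eq_right)
      then show ?thesis using n0 \<tau>0 by (simp add: z_def field_simps power2_eq_square)
    qed
    ultimately show ?thesis unfolding a_def by simp
  qed
  have cols: "(\<lambda>k. a k m) sums A m" for m
  proof -
    define n where "n = complex_of_nat (Suc m)"
    have n0: "n \<noteq> 0" unfolding n_def by (simp del: of_nat_Suc)
    define z where "z = n * \<sigma>"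
    have z: "Im z > 0" using \<sigma> by (simp add: z_def n_def)
    \<comment> \<open>Since \<open>z = - n / \<tau>\<close>, clearing \<open>\<tau>^2\<close>
      reverses the roles of the two squares, and the same array appears with \<open>k\<close> as
      summation index.\<close>
    have "2 * z / (z\<^sup>2 - (of_nat (Suc k))\<^sup>2) / (2 * n * \<tau>) = a k m" for k
    proof -
      define l where "l = complex_of_nat (Suc k)"
      define q where "q = l\<^sup>2 * \<tau>\<^sup>2 - n\<^sup>2"
      have "z\<^sup>2 - l\<^sup>2 = - q / \<tau>\<^sup>2"
        using \<tau>0 by (simp add: z_def \<sigma>_def q_def field_simps)
      then have "2 * z / (z\<^sup>2 - l\<^sup>2) / (2 * n * \<tau>) = 1 / q"
        using \<tau>0 n0 by (simp add: z_def \<sigma>_def power2_eq_square)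
      then show ?thesis by (simp only: a_def l_def n_def q_def)
    qed
    with sums_divide[OF pfd[OF z], of "2 * n * \<tau>"]
    have "(\<lambda>k. a k m) sums ((- of_real pi * \<i> - 2 * of_real pi * \<i> * K z - 1 / z) / (2 * n * \<tau>))"
      by simp
    moreover have "(- of_real pi * \<i> - 2 * of_real pi * \<i> * K z - 1 / z) / (2 * n * \<tau>) = A m"
    proof -
      have "complex_of_nat ((m + 1)\<^sup>2) = n\<^sup>2" by (simp add: n_def)
      then have Am: "A m = (- of_real pi * \<i> / (2 * \<tau>)) * (1 / n) - (of_real pi * \<i> / \<tau>) * (K z / n) + (1 / 2) * (1 / n\<^sup>2)"
        by (simp only: A_def n_def[symmetric] z_def)
      have inv: "1 / z = - \<tau> / n" by (simp add: z_def \<sigma>_def)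
      show ?thesis unfolding Am inv using n0 \<tau>0 by (simp add: field_simps power2_eq_square)
    qed
    ultimately show ?thesis by simp
  qed
  have squares: "(\<lambda>k. 1 / complex_of_nat ((k + 1)\<^sup>2)) sums (of_real (pi\<^sup>2 / 6))"
    using sums_of_real[OF inverse_squares_sums, where 'a = complex] by simp
  have alt_squares: "(\<lambda>k. (-1) ^ Suc k * (1 / complex_of_nat ((k + 1)\<^sup>2))) sums (of_real (- (pi\<^sup>2 / 12)))"
  proof -
    have "1 / complex_of_nat ((2 * Suc k)\<^sup>2) = 1 / complex_of_nat ((k + 1)\<^sup>2) / 4" for k
    proof -
      have "(2 * Suc k)\<^sup>2 = 4 * (k + 1)\<^sup>2" by (simp add: power2_eq_square)
      then show ?thesis by (simp only: of_nat_mult of_nat_numeral) simp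
    qed
    with sums_divide[OF squares, of 4]
    have "(\<lambda>k. 1 / complex_of_nat ((2 * Suc k)\<^sup>2)) sums (of_real (pi\<^sup>2 / 6) / 4)" by simp
    moreover have "(\<lambda>k. 1 / complex_of_nat ((Suc k)\<^sup>2)) sums (of_real (pi\<^sup>2 / 6))" using squares by simp
    ultimately have "(\<lambda>k. (-1) ^ Suc k * (1 / complex_of_nat ((Suc k)\<^sup>2))) sums
        (2 * (of_real (pi\<^sup>2 / 6) / 4) - of_real (pi\<^sup>2 / 6))"
      by (intro sums_alternating[where F = "\<lambda>k. 1 / complex_of_nat (k\<^sup>2)"])
    then show ?thesis by simp
  qed
  have alt_harmonic: "(\<lambda>k. (-1) ^ Suc k * (1 / complex_of_nat (Suc k))) sums (- of_real (ln 2))"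
    using sums_minus[OF sums_of_real[OF alternating_harmonic_series_sums, where 'a = complex]] by simp
  have half: "Im (\<tau> / 2) > 0" using assms by simp
  have Rsum: "R sums ((- of_real pi * \<i> / \<tau>) * (lambert (\<tau> / 2) - lambert \<tau>) - 1 / (2 * \<tau>\<^sup>2) * of_real (pi\<^sup>2 / 6))"
    unfolding R_def by (intro sums_diff sums_mult lam squares assms half)
  \<comment> \<open>Here the constant term of the cotangent meets the sign and yields the
    alternating harmonic series.\<close>
  have Asum: "(\<lambda>m. (-1) ^ Suc m * A m) sums
      ((- of_real pi * \<i> / (2 * \<tau>)) * (- of_real (ln 2))
      - (of_real pi * \<i> / \<tau>) * (lambert (2 * \<sigma>) - lambert \<sigma>) + (1 / 2) * of_real (- (pi\<^sup>2 / 12)))"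
  proof -
    have alt: "(\<lambda>k. (-1) ^ Suc k * (K (of_nat (Suc k) * \<sigma>) / of_nat (Suc k))) sums (lambert (2 * \<sigma>) - lambert \<sigma>)"
      using alternating_sums_lambert[OF \<sigma>] by (simp only: K_def)
    have "(-1) ^ Suc m * A m = (- of_real pi * \<i> / (2 * \<tau>)) * ((-1) ^ Suc m * (1 / of_nat (Suc m)))
      - (of_real pi * \<i> / \<tau>) * ((-1) ^ Suc m * (K (of_nat (Suc m) * \<sigma>) / of_nat (Suc m)))
      + (1 / 2) * ((-1) ^ Suc m * (1 / of_nat ((m + 1)\<^sup>2)))" for m
      unfolding A_def by (simp only: distrib_left right_diff_distrib mult.left_commute)
    then show ?thesis
      by (simp only:) (intro sums_add sums_diff sums_mult alt alt_harmonic alt_squares)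
  qed
  obtain C where C: "norm (a k (2 * j + 1) - a k (2 * j)) \<le>
      C * (real (Suc k) powr (-3/2) * real (Suc j) powr (-3/2))" for k j
    using lattice_difference_bound[OF assms] unfolding a_def by metis
  from alternating_double_sums_swap[OF C rows cols Rsum Asum]
  have "(- of_real pi * \<i> / \<tau>) * (lambert (\<tau> / 2) - lambert \<tau>) - 1 / (2 * \<tau>\<^sup>2) * of_real (pi\<^sup>2 / 6) =
      (- of_real pi * \<i> / (2 * \<tau>)) * (- of_real (ln 2))
      - (of_real pi * \<i> / \<tau>) * (lambert (2 * \<sigma>) - lambert \<sigma>) + (1 / 2) * of_real (- (pi\<^sup>2 / 12))" .
  then have key: "lambert (\<tau> / 2) - lambert \<tau> = of_real pi * \<i> / (12 * \<tau>)
      - of_real (ln 2) / 2 + (lambert (2 * \<sigma>) - lambert \<sigma>) - of_real pi * \<i> * \<tau> / 24"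
    by (intro solve_lambert_equation) (use \<tau>0 in auto)
  have "of_real pi * \<i> * \<sigma> / 12 = - of_real pi * \<i> / (12 * \<tau>)" by (simp add: \<sigma>_def)
  then show ?thesis
    unfolding weber_f1_eq_exp[OF assms] weber_f2_eq_exp[OF \<sigma>] \<sigma>_def[symmetric] key
    by (simp add: algebra_simps)
qed

section \<open>Action of S and T on the Weber triple\<close>

lemma zeta_nonzero [simp]: "zeta k \<noteq> 0"
  by (simp add: zeta_def)

lemma zeta_mult_power: "m > 0 \<Longrightarrow> zeta (n * m) ^ m = zeta n"
  by (simp add: zeta_def flip: exp_of_nat_mult)

lemma zeta_self_power: "n > 0 \<Longrightarrow> zeta n ^ n = 1"
  using zeta_mult_power[of n 1] by (simp add: zeta_def)

lemma zeta_eq_power_zeta_48: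
  "zeta 24 = zeta 48 ^ 2" "zeta 16 = zeta 48 ^ 3" "zeta 12 = zeta 48 ^ 4" "zeta 8 = zeta 48 ^ 6" "zeta 3 = zeta 48 ^ 16"
  using zeta_mult_power[of 2 24] zeta_mult_power[of 3 16] zeta_mult_power[of 4 12] zeta_mult_power[of 6 8]
    zeta_mult_power[of 16 3] by simp_all

lemma Im_inversion_pos: "Im \<tau> > 0 \<Longrightarrow> Im (-1 / \<tau>) > 0"
  by (simp add: Im_divide divide_pos_pos sum_power2_gt_zero_iff)

lemma weber_f_inversion:
  assumes "Im \<tau> > 0"
  shows "weber_f (-1 / \<tau>) = weber_f \<tau>"
proof -
  have "weber_f (-1 / \<tau>) * weber_f1 (-1 / \<tau>) * weber_f2 (-1 / \<tau>) = weber_f \<tau> * weber_f1 \<tau> * weber_f2 \<tau>"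
    using assms Im_inversion_pos by (simp only: weber_product)
  moreover have "weber_f1 (-1 / \<tau>) = weber_f2 \<tau>" "weber_f2 (-1 / \<tau>) = weber_f1 \<tau>"
    using weber_f1_eq_weber_f2_inversion[OF Im_inversion_pos[OF assms]]
      weber_f1_eq_weber_f2_inversion[OF assms] by simp_all
  moreover have "weber_f1 \<tau> \<noteq> 0" "weber_f2 \<tau> \<noteq> 0"
    using assms by (simp_all add: weber_f1_eq_exp weber_f2_eq_exp)
  ultimately show ?thesis by simp
qed

lemma weber_triple_inversion:
  assumes "\<tau> \<in> upper_half_plane"
  shows "weber_triple (-1 / \<tau>) = vector [u0 \<tau>, zeta 8 * u2 \<tau>, inverse (zeta 8) * u1 \<tau>]"
proof -
  have \<tau>: "Im \<tau> > 0" using assms by (simp add: upper_half_plane_def)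
  have "weber_f1 (-1 / \<tau>) = weber_f2 \<tau>" "weber_f2 (-1 / \<tau>) = weber_f1 \<tau>"
    using weber_f1_eq_weber_f2_inversion[OF Im_inversion_pos[OF \<tau>]]
      weber_f1_eq_weber_f2_inversion[OF \<tau>] by simp_all
  moreover have "zeta 8 = zeta 16 ^ 2" using zeta_mult_power[of 2 8] by simp
  ultimately have "u1 (-1 / \<tau>) = zeta 8 * u2 \<tau>" "u2 (-1 / \<tau>) = inverse (zeta 8) * u1 \<tau>"
    by (simp_all add: u1_def u2_def power2_eq_square)
  then show ?thesis
    using weber_f_inversion[OF \<tau>] by (simp only: weber_triple_def u0_def)
qed

lemma eta_add_1: "eta (\<tau> + 1) = zeta 24 * eta \<tau>"
proof -
  have "exp (2 * of_real pi * \<i> * of_nat (Suc k) * (\<tau> + 1)) = exp (2 * of_real pi * \<i> * of_nat (Suc k) * \<tau>)" for k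
  proof -
    have "exp (2 * of_real pi * \<i> * of_nat (Suc k)) = (1 :: complex)"
      using exp_of_nat_mult[of "Suc k" "2 * of_real pi * \<i> :: complex"] by (simp add: mult_ac del: of_nat_Suc)
    then show ?thesis by (simp only: distrib_left exp_add) simp
  qed
  then show ?thesis
    unfolding eta_def by (simp only:) (simp add: zeta_def distrib_left add_divide_distrib exp_add mult_ac)
qed

lemma weber_triple_add_1:
  "weber_triple (\<tau> + 1) = vector [inverse (zeta 12) * u1 \<tau>, zeta 24 * u0 \<tau>, zeta 24 * u2 \<tau>]"
proof -
  \<comment> \<open>Adding 1 exchanges the arguments \<open>\<tau> / 2\<close> and
    \<open>(\<tau> + 1) / 2\<close> modulo 1, hence \<open>weber_f\<close> and
    \<open>weber_f1\<close>; the argument \<open>2 * \<tau>\<close> moves by 2 and picks up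
    \<open>zeta 24\<close> twice.\<close>
  have "(\<tau> + 1 + 1) / 2 = \<tau> / 2 + 1" "2 * (\<tau> + 1) = 2 * \<tau> + 1 + 1" by (simp_all add: add_divide_distrib)
  then have "eta ((\<tau> + 1 + 1) / 2) = zeta 24 * eta (\<tau> / 2)" "eta (2 * (\<tau> + 1)) = zeta 24 * (zeta 24 * eta (2 * \<tau>))"
    by (simp_all only: eta_add_1)
  note eqs = this eta_add_1 u0_def u1_def u2_def weber_f_def weber_f1_def weber_f2_def zeta_eq_power_zeta_48
  have "u0 (\<tau> + 1) = inverse (zeta 12) * u1 \<tau>" "u1 (\<tau> + 1) = zeta 24 * u0 \<tau>" "u2 (\<tau> + 1) = zeta 24 * u2 \<tau>"
    unfolding eqs by (simp_all add: field_simps eval_nat_numeral)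
  then show ?thesis by (simp only: weber_triple_def)
qed

section \<open>Generators of the modular group and its reductions\<close>

definition mat2 :: "'a::zero \<Rightarrow> 'a \<Rightarrow> 'a \<Rightarrow> 'a \<Rightarrow> 'a^2^2" where
  "mat2 a b c d = vector [vector [a, b], vector [c, d]]"

lemma mat2_nth [simp]:
  "mat2 a b c d $ 1 $ 1 = a" "mat2 a b c d $ 1 $ 2 = b"
  "mat2 a b c d $ 2 $ 1 = c" "mat2 a b c d $ 2 $ 2 = d"
  by (simp_all add: mat2_def)

lemma mat2_eta: "mat2 (A $ 1 $ 1) (A $ 1 $ 2) (A $ 2 $ 1) (A $ 2 $ 2) = A"
  by (simp add: vec_eq_iff forall_2)

lemma mat2_cases: obtains a b c d where "A = mat2 a b c d"
  by (metis mat2_eta)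

lemma mat2_eq_iff: "mat2 a b c d = mat2 a' b' c' d' \<longleftrightarrow> a = a' \<and> b = b' \<and> c = c' \<and> d = d'"
  by (auto simp: vec_eq_iff forall_2)

lemma mat2_mult:
  "mat2 a b c d ** mat2 a' b' c' d' =
    mat2 (a * a' + b * c') (a * b' + b * d') (c * a' + d * c') (c * b' + d * d' :: 'a :: comm_ring_1)"
  by (simp add: vec_eq_iff forall_2 matrix_matrix_mult_def sum_2)

lemma det_mat2: "det (mat2 a b c d) = a * d - b * (c :: 'a :: comm_ring_1)"
  by (simp add: det_2)

lemma mat_1_eq_mat2: "mat 1 = mat2 1 0 0 (1 :: 'a :: comm_ring_1)"
  by (simp add: vec_eq_iff forall_2 mat_def)

lemma uminus_mat2: "- mat2 a b c d = mat2 (- a) (- b) (- c) (- d :: 'a :: comm_ring_1)"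
  by (simp add: vec_eq_iff forall_2)

text \<open>For \<open>n = 0\<close> the following says that the modular group is generated by \<open>S\<close> and \<open>T\<close>. Modulo
  \<open>n > 0\<close>, the Euclidean algorithm stops at a diagonal matrix, which the Whitehead identity resolves.\<close>

lemma SL2_mod_induct:
  fixes n :: int and P :: "int \<Rightarrow> int \<Rightarrow> int \<Rightarrow> int \<Rightarrow> bool"
  assumes one: "P 1 0 0 1"
    and S: "\<And>a b c d. [a * d - b * c = 1] (mod n) \<Longrightarrow> P a b c d \<Longrightarrow> P b (- a) d (- c)"
    and T: "\<And>a b c d. [a * d - b * c = 1] (mod n) \<Longrightarrow> P a b c d \<Longrightarrow> P a (a + b) c (c + d)"
    and cong: "\<And>a b c d a' b' c' d'. [a * d - b * c = 1] (mod n) \<Longrightarrow> P a b c d \<Longrightarrow> [a = a'] (mod n) \<Longrightarrow>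
      [b = b'] (mod n) \<Longrightarrow> [c = c'] (mod n) \<Longrightarrow> [d = d'] (mod n) \<Longrightarrow> P a' b' c' d'"
    and det: "[a * d - b * c = 1] (mod n)"
  shows "P a b c d"
proof -
  define Q where "Q a b c d \<longleftrightarrow> [a * d - b * c = 1] (mod n) \<and> P a b c d" for a b c d
  have Q1: "Q 1 0 0 1" by (simp add: Q_def one)
  have QS: "Q b (- a) d (- c)" if "Q a b c d" for a b c d
  proof -
    have "b * (- c) - (- a) * d = a * d - b * c" by simp
    with that S show ?thesis by (simp add: Q_def)
  qed
  have QT: "Q a (a + b) c (c + d)" if "Q a b c d" for a b c d
  proof -
    have "a * (c + d) - (a + b) * c = a * d - b * c" by (simp add: algebra_simps)
    with that T show ?thesis by (simp add: Q_def)
  qed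
  have QS': "Q (- b) a (- d) c" if "Q a b c d" for a b c d
    using QS[OF QS[OF QS[OF that]]] by simp
  \<comment> \<open>Only forward steps are given, so T^-1 is written as the word S T S T S^3, using
    (ST)^3 = -1 and S^2 = -1.\<close>
  have QT': "Q a (b - a) c (d - c)" if "Q a b c d" for a b c d
    using QS[OF QS[OF QS[OF QT[OF QS[OF QT[OF QS[OF that]]]]]]] by simp
  have QTk: "Q a (b + k * a) c (d + k * c)" if "Q a b c d" for a b c d k
  proof (induction k rule: int_induct[where k = 0])
    case base
    then show ?case using that by simp
  next
    case (step1 i)
    from QT[OF step1(2)] show ?case by (simp add: algebra_simps)
  next
    case (step2 i)
    from QT'[OF step2(2)] show ?case by (simp add: algebra_simps)
  qed
  have Qcong: "Q a' b' c' d'" if "Q a b c d" "[a = a'] (mod n)" "[b = b'] (mod n)" "[c = c'] (mod n)" "[d = d'] (mod n)"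
    for a b c d a' b' c' d'
  proof -
    have "[a * d - b * c = a' * d' - b' * c'] (mod n)"
      using that by (intro cong_diff cong_mult)
    then have "[a' * d' - b' * c' = 1] (mod n)"
      using that(1) by (meson Q_def cong_sym cong_trans)
    then show ?thesis using that cong[of a d b c] by (auto simp: Q_def)
  qed
  \<comment> \<open>The word is S T^-d S^-1 T^-a S^-1 T^-d; the entry \<open>1 - a * d\<close> is
    replaced by 0 on the way and again at the end.\<close>
  have diag: "Q a 0 0 d" if "[a * d = 1] (mod n)" for a d
  proof -
    have zero: "[1 - a * d = 0] (mod n)" "[1 - d * a = 0] (mod n)"
      using cong_diff[OF cong_refl that, of 1] by (simp_all add: mult.commute)
    have "Q 0 (-1) 1 0" using QS[OF Q1] by simp
    from QTk[OF this, of "- d"] have "Q 0 (-1) 1 (- d)" by simp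
    from QTk[OF QS'[OF this], of "- a"] have "Q 1 (- a) d (1 - a * d)" by simp
    then have "Q 1 (- a) d 0" by (rule Qcong) (use zero in auto)
    from QTk[OF QS'[OF this], of "- d"] have "Q a (1 - d * a) 0 d" by simp
    then show ?thesis by (rule Qcong) (use zero in auto)
  qed
  have upper: "Q a b 0 d" if "[a * d = 1] (mod n)" for a b d
  proof -
    have "[b * d * a = b] (mod n)"
      using cong_mult[OF cong_refl that, of b] by (simp add: mult_ac)
    moreover have "Q a (b * d * a) 0 d" using QTk[OF diag[OF that], of "b * d"] by simp
    ultimately show ?thesis by (intro Qcong[of a "b * d * a" 0 d a b 0 d] cong_refl)
  qed
  have "Q a b c d" if "[a * d - b * c = 1] (mod n)" for a b c d
    using that
  proof (induction "nat \<bar>c\<bar>" arbitrary: a b c d rule: less_induct)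
    case less
    show ?case
    proof (cases "c = 0")
      case True
      then show ?thesis using upper less.prems by simp
    next
      case False
      \<comment> \<open>Right multiplication by T^-k and then S moves \<open>d mod c\<close> into
        the lower left corner: a Euclidean step on the bottom row.\<close>
      define k where "k = d div c"
      have dk: "d - k * c = d mod c" by (simp add: k_def minus_div_mult_eq_mod)
      have "\<bar>d mod c\<bar> < \<bar>c\<bar>" using False by (rule abs_mod_less)
      moreover have "[(b - k * a) * (- c) - (- a) * (d mod c) = 1] (mod n)"
        using less.prems unfolding dk[symmetric] by (simp add: algebra_simps)
      ultimately have "Q (b - k * a) (- a) (d mod c) (- c)"
        by (intro less.hyps) auto
      from QTk[OF QS'[OF this], of k] show ?thesis by (simp add: dk[symmetric])
    qed
  qed
  then show ?thesis using det by (simp add: Q_def)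
qed

section \<open>The monomial representation modulo 48\<close>

text \<open>The line spanned by the third unit vector corresponds to the row vector \<open>(0, 1)\<close> modulo 2, so its
  image under a matrix is determined by the bottom row \<open>(c, d)\<close> modulo 2. For even \<open>c\<close> the coefficient is the
  multiplier of \<open>\<eta>(2\<tau>)/\<eta>(\<tau>)\<close> on \<open>\<Gamma>\<^sub>0(2)\<close>, split into the 2-part \<open>theta16\<close> and the 3-part \<open>theta3\<close>;
  the odd cases are obtained from it by multiplication with \<open>S\<close> and \<open>ST\<close>. The values of \<open>theta16\<close> are
  even whenever the determinant is odd, so only 8th roots of unity arise from it.\<close>

definition theta16 :: "int \<Rightarrow> int \<Rightarrow> int \<Rightarrow> int \<Rightarrow> int" where
  "theta16 a b c d =
     (if even c then 3 * d * (2 * b + c) + d\<^sup>2 - 1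
      else if even d then 3 * c * (2 * a - d) + c\<^sup>2 + 1
      else 3 * c * (2 * a - d) + 9)"

text \<open>The negative of the classical exponent \<open>(a + d) * c - b * d * (c^2 - 1)\<close> in
  the multiplier of eta, read modulo 3. On SL2(Z/3) it is an additive character, whence a single
  polynomial without parity cases.\<close>

definition theta3 :: "int \<Rightarrow> int \<Rightarrow> int \<Rightarrow> int \<Rightarrow> int" where
  "theta3 a b c d = b * d * (c\<^sup>2 - 1) - (a + d) * c"

text \<open>A 48th root of unity in its Chinese remainder form, so that the exponents matter only
  modulo 16 and modulo 3.\<close>

definition zeta48_exp :: "int \<Rightarrow> int \<Rightarrow> complex" where
  "zeta48_exp m n = zeta 16 powi m * zeta 3 powi n"

definition bottom_row :: "int \<Rightarrow> int \<Rightarrow> int \<Rightarrow> int \<Rightarrow> complex^3" where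
  "bottom_row a b c d =
     (let z = zeta48_exp (theta16 a b c d) (theta3 a b c d)
      in if even c then vector [0, 0, z] else if even d then vector [0, z, 0] else vector [z, 0, 0])"

text \<open>The first two unit vectors are, up to a factor, the images of the third one under \<open>ST\<close> and \<open>S\<close>;
  hence the bottom rows of \<open>STg\<close> and \<open>Sg\<close>.\<close>

definition weber_matrix :: "int \<Rightarrow> int \<Rightarrow> int \<Rightarrow> int \<Rightarrow> complex^3^3" where
  "weber_matrix a b c d = vector
     [(zeta 24 ^ 2 / zeta 8) *s bottom_row (- c) (- d) (a + c) (b + d),
      (1 / zeta 8) *s bottom_row (- c) (- d) a b,
      bottom_row a b c d]"

definition weber_S :: "complex^3^3" where
  "weber_S = vector [vector [1, 0, 0], vector [0, 0, inverse (zeta 8)], vector [0, zeta 8, 0]]"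

definition weber_T :: "complex^3^3" where
  "weber_T = vector [vector [0, zeta 24, 0], vector [inverse (zeta 24 ^ 2), 0, 0], vector [0, 0, zeta 24]]"

lemma zeta_powi_cong:
  assumes "[m = m'] (mod int n)" "n > 0"
  shows "zeta n powi m = zeta n powi m'"
proof -
  obtain k where "m - m' = int n * k" using assms(1) by (auto simp: cong_iff_dvd_diff)
  then have "m = m' + int n * k" by simp
  then show ?thesis
    using zeta_self_power[OF assms(2)] by (simp add: power_int_add power_int_mult)
qed

lemma zeta48_exp_add: "zeta48_exp (m + m') (n + n') = zeta48_exp m n * zeta48_exp m' n'"
  by (simp add: zeta48_exp_def power_int_add)

lemma zeta48_exp_cong:
  "[m = m'] (mod 16) \<Longrightarrow> [n = n'] (mod 3) \<Longrightarrow> zeta48_exp m n = zeta48_exp m' n'"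
  using zeta_powi_cong[of m m' 16] zeta_powi_cong[of n n' 3] by (simp add: zeta48_exp_def)

lemma zeta48_exp_0 [simp]: "zeta48_exp 0 0 = 1"
  by (simp add: zeta48_exp_def)

lemma zeta48_exp_zeta_8: "zeta 8 = zeta48_exp 2 0" "inverse (zeta 8) = zeta48_exp (-2) 0"
  using zeta_mult_power[of 2 8] by (simp_all add: zeta48_exp_def power_int_minus)

text \<open>1/24 = 6/16 - 1/3 and -2/24 = 4/16 - 1/3.\<close>

lemma zeta48_exp_zeta_24: "zeta 24 = zeta48_exp 6 (-1)" "inverse (zeta 24 ^ 2) = zeta48_exp 4 (-1)"
proof -
  have "zeta 3 \<noteq> 0" by simp
  have "zeta 24 * zeta 3 = zeta 16 ^ 6"
    unfolding zeta_eq_power_zeta_48 by (simp flip: power_mult power_add)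
  then have *: "zeta 24 = zeta 16 ^ 6 / zeta 3" by (simp add: field_simps)
  then show "zeta 24 = zeta48_exp 6 (-1)"
    by (simp add: zeta48_exp_def power_int_minus divide_inverse)
  have "zeta 24 ^ 2 * zeta48_exp 4 (-1) = zeta48_exp 16 (-3)"
    unfolding power2_eq_square \<open>zeta 24 = zeta48_exp 6 (-1)\<close> by (simp flip: zeta48_exp_add)
  also have "\<dots> = 1" using zeta48_exp_cong[of 16 0 "-3" 0] by (simp add: cong_iff_dvd_diff)
  finally show "inverse (zeta 24 ^ 2) = zeta48_exp 4 (-1)"
    by (rule inverse_unique)
qed

section \<open>The exponents under right multiplication by S and T\<close>

lemma odd_square_mod_8:
  fixes d :: int
  assumes "odd d"
  obtains i where "d\<^sup>2 = 8 * i + 1"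
proof -
  obtain k where k: "d = 2 * k + 1" using assms by (auto elim: oddE)
  have "even (k * (k + 1))" by simp
  then obtain l where "k * (k + 1) = 2 * l" by (metis evenE)
  then have "d\<^sup>2 = 8 * l + 1" unfolding k by (simp add: power2_eq_square algebra_simps)
  then show ?thesis by (rule that)
qed

text \<open>Odd residues are their own inverses modulo 8.\<close>

lemma det_solve_mod_8:
  fixes a b c d :: int
  assumes "odd d" "[a * d - b * c = 1] (mod 8)"
  obtains k where "a = d * (1 + b * c) + 8 * k"
proof -
  obtain i where i: "d\<^sup>2 = 8 * i + 1" using odd_square_mod_8[OF assms(1)] .
  obtain j where j: "a * d - b * c - 1 = 8 * j" using assms(2) by (auto simp: cong_iff_dvd_diff)
  have "a * d\<^sup>2 = d * (a * d)" by (simp add: power2_eq_square)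
  also have "a * d = 1 + b * c + 8 * j" using j by simp
  finally have "a * d\<^sup>2 = d * (1 + b * c + 8 * j)" .
  then have "a = d * (1 + b * c) + 8 * (d * j - a * i)" unfolding i by (simp add: algebra_simps)
  then show ?thesis by (rule that)
qed

lemma odd_bottom_row:
  fixes a b c d :: int
  assumes "[a * d - b * c = 1] (mod n)" "even n"
  shows "odd c \<or> odd d"
proof (rule ccontr)
  assume "\<not> (odd c \<or> odd d)"
  then have "2 dvd a * d - b * c" by simp
  moreover have "2 dvd a * d - b * c - 1"
    by (rule dvd_trans[OF assms(2)]) (use assms(1) in \<open>simp add: cong_iff_dvd_diff\<close>)
  ultimately have "2 dvd (a * d - b * c) - (a * d - b * c - 1)" by (rule dvd_diff)
  then show False by simp
qed

lemma theta3_S: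
  assumes "[a * d - b * c = 1] (mod 3)"
  shows "[theta3 b (- a) d (- c) = theta3 a b c d] (mod 3)"
proof -
  have "theta3 b (- a) d (- c) - theta3 a b c d = 3 * (c * d) + c * d * (a * d - b * c - 1)"
    by (simp add: theta3_def power2_eq_square algebra_simps)
  moreover have "3 dvd a * d - b * c - 1" using assms by (simp add: cong_iff_dvd_diff)
  ultimately show ?thesis by (simp add: cong_iff_dvd_diff)
qed

text \<open>The increment is constant modulo \<open>a * d - b * c - 1\<close> and the Fermat
  relation \<open>c ^ 3 = c\<close> modulo 3.\<close>

lemma theta3_T:
  assumes "[a * d - b * c = 1] (mod 3)"
  shows "[theta3 a (a + b) c (c + d) = theta3 a b c d + (-1)] (mod 3)"
proof -
  have "theta3 a (a + b) c (c + d) - (theta3 a b c d + (-1)) =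
      (c ^ 3 - c) * (a + 2 * b) + (c\<^sup>2 - 1) * (a * d - b * c - 1)"
    by (simp add: theta3_def power2_eq_square power3_eq_cube algebra_simps)
  moreover have "3 dvd a * d - b * c - 1" using assms by (simp add: cong_iff_dvd_diff)
  moreover have "3 dvd c ^ 3 - c"
  proof -
    have "c mod 3 = 0 \<or> c mod 3 = 1 \<or> c mod 3 = 2" by presburger
    then have "c ^ 3 mod 3 = c mod 3" by (auto simp flip: power_mod[of c])
    then show ?thesis by (simp add: mod_eq_dvd_iff)
  qed
  ultimately show ?thesis by (simp add: cong_iff_dvd_diff)
qed

text \<open>S exchanges the first two branches of \<open>theta16\<close> exactly, up to the constant
  2. If \<open>c\<close> and \<open>d\<close> are both odd, the difference is
  \<open>6 * (b * d - a * c + c * d)\<close>, and the bracket must be divisible by 8.\<close>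

lemma theta16_S:
  assumes "[a * d - b * c = 1] (mod 16)"
  shows "[theta16 b (- a) d (- c) = theta16 a b c d + (if even c then 2 else if even d then -2 else 0)] (mod 16)"
proof (cases "even c \<or> even d")
  case True
  moreover have "odd c \<or> odd d" using odd_bottom_row[OF assms] by simp
  ultimately have "theta16 b (- a) d (- c) = theta16 a b c d + (if even c then 2 else if even d then -2 else 0)"
    by (auto simp: theta16_def algebra_simps)
  then show ?thesis by simp
next
  case False
  then have odd: "odd c" "odd d" by auto
  obtain i where i: "c\<^sup>2 = 8 * i + 1" using odd_square_mod_8[OF odd(1)] .
  obtain j where j: "d\<^sup>2 = 8 * j + 1" using odd_square_mod_8[OF odd(2)] .
  obtain k where k: "a * d - b * c = 1 + 16 * k"
    using assms by (metis cong_iff_lin cong_sym)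
  \<comment> \<open>Multiplying by the unit \<open>c * d\<close> modulo 8 creates squares of odd
    numbers; these are 1 modulo 8, and what is left is 1 minus the determinant.\<close>
  have "c * d * (b * d - a * c + c * d) = b * c * d\<^sup>2 - a * d * c\<^sup>2 + c\<^sup>2 * d\<^sup>2"
    by (simp add: power2_eq_square algebra_simps)
  also have "\<dots> = (1 - (a * d - b * c)) + 8 * (b * c * j - a * d * i + 8 * i * j + i + j)"
    unfolding i j by (simp add: algebra_simps)
  also have "\<dots> = 8 * (b * c * j - a * d * i + 8 * i * j + i + j - 2 * k)"
    unfolding k by (simp add: algebra_simps)
  finally have "8 dvd c * d * (b * d - a * c + c * d)" by simp
  moreover have "coprime (2 ^ 3) (c * d)" using odd by (simp only: coprime_power_left_iff) simp
  ultimately have "8 dvd b * d - a * c + c * d"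
    using coprime_dvd_mult_right_iff[of "2 ^ 3" "c * d"] by simp
  then obtain l where "b * d - a * c + c * d = 8 * l" by blast
  then have "theta16 b (- a) d (- c) - theta16 a b c d = 16 * (3 * l)"
    using odd by (simp add: theta16_def algebra_simps)
  then show ?thesis using odd by (simp add: cong_iff_dvd_diff)
qed

text \<open>For odd \<open>c\<close> the claim reduces to \<open>c^2 = 1\<close> modulo 8. For
  \<open>c = 2 * c'\<close> the critical term is \<open>4 * c' * (3 * a + 6 * b + d)\<close>;
  eliminating \<open>a\<close> modulo 8 leaves \<open>6 * b * c' * (c' * d + 1)\<close> inside the
  factor 4, and \<open>c' * (c' * d + 1)\<close> is even because \<open>d\<close> is odd.\<close>

lemma theta16_T:
  assumes "[a * d - b * c = 1] (mod 16)"
  shows "[theta16 a (a + b) c (c + d) = theta16 a b c d + (if odd c \<and> even d then 4 else 6)] (mod 16)"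
proof (cases "even c")
  case True
  then obtain c' where c': "c = 2 * c'" by auto
  have mod8: "[a * d - b * c = 1] (mod 8)"
    by (rule cong_dvd_modulus[OF assms]) simp
  have "odd d" using odd_bottom_row[OF assms] True by simp
  obtain k where k: "a = d * (1 + b * c) + 8 * k" using det_solve_mod_8[OF \<open>odd d\<close> mod8] .
  obtain j where j: "a * d - b * c = 1 + 16 * j" using assms by (metis cong_iff_lin cong_sym)
  have "even (c' * (c' * d + 1))" using \<open>odd d\<close> by simp
  then obtain m where m: "c' * (c' * d + 1) = 2 * m" by (metis evenE)
  have "theta16 a (a + b) c (c + d) - (theta16 a b c d + 6) =
      6 * (a * d - b * c - 1) + 4 * (c' * (3 * a + 6 * b + d)) + 16 * c'\<^sup>2"
    using True unfolding theta16_def by (simp add: c' power2_eq_square algebra_simps)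
  also have "c' * (3 * a + 6 * b + d) = 4 * (c' * d) + 24 * (c' * k) + 6 * b * (c' * (c' * d + 1))"
    unfolding k c' by (simp add: algebra_simps)
  also have "6 * (a * d - b * c - 1) + 4 * (4 * (c' * d) + 24 * (c' * k) + 6 * b * (c' * (c' * d + 1))) + 16 * c'\<^sup>2
      = 16 * (6 * j + c' * d + 6 * (c' * k) + 3 * b * m + c'\<^sup>2)"
    unfolding j m by (simp add: algebra_simps)
  finally show ?thesis using True by (simp add: cong_iff_dvd_diff)
next
  case False
  obtain i where i: "c\<^sup>2 = 8 * i + 1" using odd_square_mod_8[OF False] .
  have "theta16 a (a + b) c (c + d) - (theta16 a b c d + (if odd c \<and> even d then 4 else 6)) =
    (if even d then 4 - 4 * c\<^sup>2 else - 2 * c\<^sup>2 - 14)"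
    using False by (simp add: theta16_def power2_eq_square algebra_simps)
  also have "\<dots> = 16 * (if even d then - 2 * i else - i - 1)"
    unfolding i by simp
  finally show ?thesis by (simp only: cong_iff_dvd_diff) simp
qed

section \<open>The matrices of the representation\<close>

lemma vector_matrix_mult_3:
  "vector [x, y, z] v* (vector [vector [a, b, c], vector [d, e, f], vector [g, h, i]] :: 'a :: comm_semiring_1^3^3) =
    vector [a * x + d * y + g * z, b * x + e * y + h * z, c * x + f * y + i * z]"
  by (simp add: vec_eq_iff forall_3 vector_matrix_mult_def sum_3 mult.commute)

lemma cong_1_dvd: "[a = 1] (mod 48) \<Longrightarrow> n dvd 48 \<Longrightarrow> [a = (1 :: int)] (mod n)"
  by (rule cong_dvd_modulus)

lemma bottom_row_S:
  assumes "[a * d - b * c = 1] (mod 48)"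
  shows "bottom_row b (- a) d (- c) = bottom_row a b c d v* weber_S"
proof -
  have 16: "[a * d - b * c = 1] (mod 16)" and 3: "[a * d - b * c = 1] (mod 3)"
    by (rule cong_1_dvd[OF assms]; simp)+
  define z where "z = zeta48_exp (theta16 a b c d) (theta3 a b c d)"
  have "zeta48_exp (theta16 b (- a) d (- c)) (theta3 b (- a) d (- c)) =
      zeta48_exp (theta16 a b c d + (if even c then 2 else if even d then -2 else 0)) (theta3 a b c d + 0)"
    by (intro zeta48_exp_cong theta16_S 16) (use theta3_S[OF 3] in simp)
  also have "\<dots> = z * (if even c then zeta 8 else if even d then inverse (zeta 8) else 1)"
    unfolding zeta48_exp_add z_def by (simp flip: zeta48_exp_zeta_8)
  finally have "zeta48_exp (theta16 b (- a) d (- c)) (theta3 b (- a) d (- c)) =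
    z * (if even c then zeta 8 else if even d then inverse (zeta 8) else 1)" .
  moreover have "odd c \<or> odd d" using odd_bottom_row[OF assms] by simp
  ultimately show ?thesis
    unfolding bottom_row_def weber_S_def Let_def z_def[symmetric]
    by (simp add: vector_matrix_mult_3 mult.commute)
qed

lemma bottom_row_T:
  assumes "[a * d - b * c = 1] (mod 48)"
  shows "bottom_row a (a + b) c (c + d) = bottom_row a b c d v* weber_T"
proof -
  have 16: "[a * d - b * c = 1] (mod 16)" and 3: "[a * d - b * c = 1] (mod 3)"
    by (rule cong_1_dvd[OF assms]; simp)+
  define z where "z = zeta48_exp (theta16 a b c d) (theta3 a b c d)"
  have "zeta48_exp (theta16 a (a + b) c (c + d)) (theta3 a (a + b) c (c + d)) =
      zeta48_exp (theta16 a b c d + (if odd c \<and> even d then 4 else 6)) (theta3 a b c d + (-1))"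
    by (intro zeta48_exp_cong theta16_T theta3_T 16 3)
  also have "\<dots> = z * (if odd c \<and> even d then inverse (zeta 24 ^ 2) else zeta 24)"
    unfolding zeta48_exp_add z_def by (simp flip: zeta48_exp_zeta_24)
  finally have "zeta48_exp (theta16 a (a + b) c (c + d)) (theta3 a (a + b) c (c + d)) =
    z * (if odd c \<and> even d then inverse (zeta 24 ^ 2) else zeta 24)" .
  then show ?thesis
    unfolding bottom_row_def weber_T_def Let_def z_def[symmetric]
    by (simp add: vector_matrix_mult_3 mult.commute)
qed

lemma bottom_row_cong:
  assumes "[a = a'] (mod 48)" "[b = b'] (mod 48)" "[c = c'] (mod 48)" "[d = d'] (mod 48)"
  shows "bottom_row a b c d = bottom_row a' b' c' d'"
proof -
  have m: "[a = a'] (mod n)" "[b = b'] (mod n)" "[c = c'] (mod n)" "[d = d'] (mod n)" if "n dvd 48" for n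
    using assms that by (auto intro: cong_dvd_modulus)
  have par: "even c = even c'" "even d = even d'"
    using m(3,4)[of 2] by (auto simp: cong_def mod_2_eq_odd split: if_splits)
  have "[3 * d * (2 * b + c) + d\<^sup>2 - 1 = 3 * d' * (2 * b' + c') + d'\<^sup>2 - 1] (mod 16)"
    "[3 * c * (2 * a - d) + c\<^sup>2 + 1 = 3 * c' * (2 * a' - d') + c'\<^sup>2 + 1] (mod 16)"
    "[3 * c * (2 * a - d) + 9 = 3 * c' * (2 * a' - d') + 9] (mod 16)"
    by (intro cong_add cong_diff cong_mult cong_pow cong_refl m; simp)+
  then have "[theta16 a b c d = theta16 a' b' c' d'] (mod 16)"
    unfolding theta16_def par by presburger
  moreover have "[theta3 a b c d = theta3 a' b' c' d'] (mod 3)"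
    unfolding theta3_def by (intro cong_add cong_diff cong_mult cong_pow cong_refl m) auto
  ultimately show ?thesis
    unfolding bottom_row_def par by (simp only: zeta48_exp_cong)
qed

text \<open>All monomials of \<open>theta16\<close> and \<open>theta3\<close> have even degree; this
  is what lets the formulas descend to the quotient by sign.\<close>

lemma bottom_row_uminus: "bottom_row (- a) (- b) (- c) (- d) = bottom_row a b c d"
  by (simp add: bottom_row_def theta16_def theta3_def algebra_simps)

lemma weber_matrix_cong:
  assumes "[a = a'] (mod 48)" "[b = b'] (mod 48)" "[c = c'] (mod 48)" "[d = d'] (mod 48)"
  shows "weber_matrix a b c d = weber_matrix a' b' c' d'"
proof -
  have neg: "[- c = - c'] (mod 48)" "[- d = - d'] (mod 48)"
    using assms by (simp_all add: cong_minus_minus_iff)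
  have "bottom_row (- c) (- d) (a + c) (b + d) = bottom_row (- c') (- d') (a' + c') (b' + d')"
    "bottom_row (- c) (- d) a b = bottom_row (- c') (- d') a' b'"
    "bottom_row a b c d = bottom_row a' b' c' d'"
    by (intro bottom_row_cong cong_add assms neg)+
  then show ?thesis by (simp only: weber_matrix_def)
qed

lemma weber_matrix_uminus: "weber_matrix (- a) (- b) (- c) (- d) = weber_matrix a b c d"
proof -
  have "bottom_row c d (- a - c) (- b - d) = bottom_row (- c) (- d) (a + c) (b + d)"
    "bottom_row c d (- a) (- b) = bottom_row (- c) (- d) a b"
    using bottom_row_uminus[of "- c" "- d" "a + c" "b + d"] bottom_row_uminus[of "- c" "- d" a b] by simp_all
  then show ?thesis by (simp add: weber_matrix_def bottom_row_uminus)
qed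

lemma scaled_rows_mult:
  fixes B :: "'a :: comm_semiring_1^3^3"
  shows "(vector [x *s u, y *s v, w] :: 'a^3^3) ** B = vector [x *s (u v* B), y *s (v v* B), w v* B]"
  by (simp add: vec_eq_iff forall_3 matrix_matrix_mult_def vector_matrix_mult_def sum_3 algebra_simps)

text \<open>The rows belong to STg, Sg and g, which share the determinant of g and are multiplied on
  the right alike, so \<open>bottom_row_S\<close> applies to each.\<close>

lemma weber_matrix_S:
  assumes "[a * d - b * c = 1] (mod 48)"
  shows "weber_matrix b (- a) d (- c) = weber_matrix a b c d ** weber_S"
proof -
  have det: "- c * (b + d) - - d * (a + c) = a * d - b * c" "- c * b - - d * a = a * d - b * c"
    by (simp_all add: algebra_simps)
  have "bottom_row (- d) (- (- c)) (b + d) (- (a + c)) = bottom_row (- c) (- d) (a + c) (b + d) v* weber_S"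
    "bottom_row (- d) (- (- c)) b (- a) = bottom_row (- c) (- d) a b v* weber_S"
    by (rule bottom_row_S; use assms in \<open>simp only: det\<close>)+
  then show ?thesis
    using bottom_row_S[OF assms] by (simp add: weber_matrix_def scaled_rows_mult)
qed

lemma weber_matrix_T:
  assumes "[a * d - b * c = 1] (mod 48)"
  shows "weber_matrix a (a + b) c (c + d) = weber_matrix a b c d ** weber_T"
proof -
  have det: "- c * (b + d) - - d * (a + c) = a * d - b * c" "- c * b - - d * a = a * d - b * c"
    by (simp_all add: algebra_simps)
  have "bottom_row (- c) (- c + - d) (a + c) (a + c + (b + d)) = bottom_row (- c) (- d) (a + c) (b + d) v* weber_T"
    "bottom_row (- c) (- c + - d) a (a + b) = bottom_row (- c) (- d) a b v* weber_T"
    by (rule bottom_row_T; use assms in \<open>simp only: det\<close>)+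
  then show ?thesis
    using bottom_row_T[OF assms] by (simp add: weber_matrix_def scaled_rows_mult algebra_simps)
qed

text \<open>The prefactors in \<open>weber_matrix\<close> are chosen for this: they undo the factors
  \<open>zeta 8 * inverse (zeta 24 ^ 2)\<close> and \<open>zeta 8\<close> that ST and S put on the
  third unit vector.\<close>

lemma weber_matrix_1: "weber_matrix 1 0 0 1 = mat 1"
proof -
  have "bottom_row 1 0 0 1 = vector [0, 0, 1]" by (simp add: bottom_row_def theta16_def theta3_def)
  moreover have "bottom_row 0 (- 1) 1 0 = vector [0, zeta 8, 0]"
    by (simp add: bottom_row_def theta16_def theta3_def zeta48_exp_zeta_8)
  moreover have "bottom_row 0 (- 1) 1 1 = vector [zeta 8 * inverse (zeta 24 ^ 2), 0, 0]"
    by (simp add: bottom_row_def theta16_def theta3_def zeta48_exp_zeta_8(1) zeta48_exp_zeta_24(2) flip: zeta48_exp_add)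
  ultimately show ?thesis
    by (simp add: weber_matrix_def vec_eq_iff forall_3 mat_def)
qed

text \<open>With the left factor fixed, both sides respond identically when the right factor is
  multiplied by S or T, so the identity spreads from the unit matrix by
  \<open>SL2_mod_induct\<close>.\<close>

lemma weber_matrix_mult:
  assumes "[a * d - b * c = 1] (mod 48)" "[a' * d' - b' * c' = 1] (mod 48)"
  shows "weber_matrix (a * a' + b * c') (a * b' + b * d') (c * a' + d * c') (c * b' + d * d') =
    weber_matrix a b c d ** weber_matrix a' b' c' d'"
proof -
  have det: "[(a * a' + b * c') * (c * b' + d * d') - (a * b' + b * d') * (c * a' + d * c') = 1] (mod 48)"
    if "[a' * d' - b' * c' = 1] (mod 48)" for a' b' c' d'
  proof -
    have "(a * a' + b * c') * (c * b' + d * d') - (a * b' + b * d') * (c * a' + d * c') =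
        (a * d - b * c) * (a' * d' - b' * c')" by (simp add: algebra_simps)
    with cong_mult[OF assms(1) that] show ?thesis by simp
  qed
  show ?thesis
  proof (induction a' b' c' d' rule: SL2_mod_induct[where n = 48])
    case 1
    then show ?case by (simp add: weber_matrix_1)
  next
    case (2 a' b' c' d')
    have "weber_matrix (a * b' + b * d') (a * - a' + b * - c') (c * b' + d * d') (c * - a' + d * - c') =
        weber_matrix (a * a' + b * c') (a * b' + b * d') (c * a' + d * c') (c * b' + d * d') ** weber_S"
      unfolding weber_matrix_S[OF det[OF 2(1)], symmetric] by simp
    then show ?case by (simp only: 2(2) weber_matrix_S[OF 2(1)] matrix_mul_assoc)
  next
    case (3 a' b' c' d')
    have "weber_matrix (a * a' + b * c') (a * (a' + b') + b * (c' + d')) (c * a' + d * c') (c * (a' + b') + d * (c' + d')) =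
        weber_matrix (a * a' + b * c') (a * b' + b * d') (c * a' + d * c') (c * b' + d * d') ** weber_T"
      unfolding weber_matrix_T[OF det[OF 3(1)], symmetric] by (simp add: algebra_simps)
    then show ?case by (simp only: 3(2) weber_matrix_T[OF 3(1)] matrix_mul_assoc)
  next
    case (4 p q r s p' q' r' s')
    have "weber_matrix (a * p' + b * r') (a * q' + b * s') (c * p' + d * r') (c * q' + d * s') =
        weber_matrix (a * p + b * r) (a * q + b * s) (c * p + d * r) (c * q + d * s)"
      by (intro weber_matrix_cong cong_add cong_mult cong_refl "4.hyps"(2-5)[THEN cong_sym])
    also have "\<dots> = weber_matrix a b c d ** weber_matrix p q r s" by (rule "4.IH")
    also have "weber_matrix p q r s = weber_matrix p' q' r' s'" by (intro weber_matrix_cong "4.hyps")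
    finally show ?case .
  qed (rule assms(2))
qed

section \<open>Passage to the quotient by sign\<close>

lemma SL2_simps [simp]:
  "carrier SL2 = {A :: 'a::comm_ring_1^2^2. det A = 1}"
  "monoid.mult SL2 = ((**) :: 'a::comm_ring_1^2^2 \<Rightarrow> _)"
  "one SL2 = (mat 1 :: 'a::comm_ring_1^2^2)"
  by (simp_all add: SL2_def)

lemma uminus_matrix_mult: "(- A) ** B = - (A ** B)" "A ** (- B) = - (A ** B)"
  for A B :: "'a::comm_ring_1^'n::finite^'n"
  by (simp_all add: vec_eq_iff matrix_matrix_mult_def sum_negf)

lemma det_uminus_2: "det (- A) = det (A :: 'a::comm_ring_1^2^2)"
  by (simp add: det_2)

lemma group_SL2: "group (SL2 :: ('a::comm_ring_1^2^2) monoid)"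
proof (rule groupI)
  fix A :: "'a^2^2"
  assume "A \<in> carrier SL2"
  obtain a b c d where A: "A = mat2 a b c d" by (rule mat2_cases)
  from \<open>A \<in> carrier SL2\<close> have "mat2 d (- b) (- c) a \<in> carrier SL2 \<and> mat2 d (- b) (- c) a \<otimes>\<^bsub>SL2\<^esub> A = \<one>\<^bsub>SL2\<^esub>"
    by (simp add: A det_mat2 mat2_mult mat_1_eq_mat2 mat2_eq_iff algebra_simps)
  then show "\<exists>B\<in>carrier SL2. B \<otimes>\<^bsub>SL2\<^esub> A = \<one>\<^bsub>SL2\<^esub>" by blast
qed (auto simp: det_mul matrix_mul_assoc matrix_mul_lid)

lemma normal_center_SL2: "{mat 1, - mat 1} \<lhd> (SL2 :: ('a::comm_ring_1^2^2) monoid)"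
proof -
  interpret group "SL2 :: ('a^2^2) monoid" by (rule group_SL2)
  show ?thesis
  proof (rule normalI)
    show "subgroup {mat 1, - mat 1} (SL2 :: ('a^2^2) monoid)"
    proof (rule subgroupI)
      fix A :: "'a^2^2"
      assume "A \<in> {mat 1, - mat 1}"
      then show "inv\<^bsub>SL2\<^esub> A \<in> {mat 1, - mat 1}"
        using inv_equality[of A A] by (auto simp: det_uminus_2 uminus_matrix_mult)
    qed (auto simp: det_uminus_2 uminus_matrix_mult)
    show "\<forall>A\<in>carrier SL2. {mat 1, - mat 1} #>\<^bsub>SL2\<^esub> A = A <#\<^bsub>SL2\<^esub> {mat 1, - mat 1 :: 'a^2^2}"
      by (auto simp: r_coset_def l_coset_def uminus_matrix_mult)
  qed
qed

text \<open>\<open>psl\<close> over an arbitrary ring, so that the same lemmas serve the integers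
  and the integers modulo 48.\<close>

definition pcoset :: "'a::comm_ring_1^2^2 \<Rightarrow> ('a^2^2) set" where
  "pcoset A = {mat 1, - mat 1} #>\<^bsub>SL2\<^esub> A"

lemma pcoset_eq: "pcoset A = {A, - A}"
  by (auto simp: pcoset_def r_coset_def uminus_matrix_mult)

lemma psl_eq_pcoset: "psl A = pcoset A"
  by (simp add: psl_def pcoset_def)

lemma group_PSL2: "group (PSL2 :: ('a::comm_ring_1^2^2) set monoid)"
  unfolding PSL2_def by (rule normal.factorgroup_is_group[OF normal_center_SL2])

lemma carrier_PSL2: "carrier PSL2 = pcoset ` {A :: 'a::comm_ring_1^2^2. det A = 1}"
  by (simp add: PSL2_def carrier_FactGroup pcoset_def[abs_def])

lemma pcoset_in_PSL2 [simp]: "det A = 1 \<Longrightarrow> pcoset A \<in> carrier PSL2"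
  by (auto simp: carrier_PSL2)

lemma pcoset_mult:
  "det A = 1 \<Longrightarrow> det B = 1 \<Longrightarrow> pcoset A \<otimes>\<^bsub>PSL2\<^esub> pcoset B = pcoset (A ** B)"
  using normal.rcos_sum[OF normal_center_SL2, of A B] by (simp add: PSL2_def pcoset_def)

lemma pcoset_one: "pcoset (mat 1) = \<one>\<^bsub>PSL2\<^esub>"
  by (simp add: PSL2_def pcoset_eq)

section \<open>Descent to SL2(Z/48) modulo sign\<close>

definition reduction :: "int^2^2 \<Rightarrow> 'a::comm_ring_1^2^2" where
  "reduction A = (\<chi> i j. of_int (A $ i $ j))"

lemma reduction_mat2: "reduction (mat2 a b c d) = mat2 (of_int a) (of_int b) (of_int c) (of_int d)"
  by (simp add: reduction_def vec_eq_iff forall_2)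

lemma reduction_mult: "reduction (A ** B) = reduction A ** reduction B"
  by (simp add: reduction_def vec_eq_iff matrix_matrix_mult_def)

lemma reduction_uminus: "reduction (- A) = - reduction A"
  by (simp add: reduction_def vec_eq_iff)

lemma det_reduction: "det (reduction A) = of_int (det A)"
  by (simp add: det_2 reduction_def)

lemma reduce48_pcoset: "reduce48 (pcoset A) = pcoset (reduction A)"
  unfolding reduce48_def reduction_def[abs_def, symmetric] pcoset_eq by (simp add: reduction_uminus)

lemma of_int_48_eq_iff: "(of_int m :: 48) = of_int n \<longleftrightarrow> [m = n] (mod 48)"
  using of_int_eq_iff_cong_CHAR[of m n, where 'a = 48] by simp

lemma reduction_eq_mat2_iff:
  "reduction (mat2 a b c d) = (reduction (mat2 a' b' c' d') :: 48^2^2) \<longleftrightarrow>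
    [a = a'] (mod 48) \<and> [b = b'] (mod 48) \<and> [c = c'] (mod 48) \<and> [d = d'] (mod 48)"
  by (simp add: reduction_mat2 mat2_eq_iff of_int_48_eq_iff)

lemma reduction_surj: obtains A where "B = (reduction A :: 48^2^2)"
proof -
  have "\<exists>m. x = of_int m" for x :: 48 by (cases x) auto
  then obtain f :: "48 \<Rightarrow> int" where f: "x = of_int (f x)" for x by metis
  then have "B = reduction (\<chi> i j. f (B $ i $ j))" by (simp add: reduction_def vec_eq_iff flip: f)
  then show ?thesis by (rule that)
qed

definition weber_mat :: "int^2^2 \<Rightarrow> complex^3^3" where
  "weber_mat A = weber_matrix (A $ 1 $ 1) (A $ 1 $ 2) (A $ 2 $ 1) (A $ 2 $ 2)"

lemma weber_mat_mat2 [simp]: "weber_mat (mat2 a b c d) = weber_matrix a b c d"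
  by (simp add: weber_mat_def)

lemma det_reduction_48: "det (reduction A :: 48^2^2) = 1 \<longleftrightarrow> [det A = 1] (mod 48)"
  using of_int_48_eq_iff[of "det A" 1] by (simp add: det_reduction)

lemma weber_mat_mult:
  assumes "[det A = 1] (mod 48)" "[det B = 1] (mod 48)"
  shows "weber_mat (A ** B) = weber_mat A ** weber_mat B"
proof -
  obtain a b c d where A: "A = mat2 a b c d" by (rule mat2_cases)
  obtain a' b' c' d' where B: "B = mat2 a' b' c' d'" by (rule mat2_cases)
  show ?thesis using assms unfolding A B by (simp add: mat2_mult det_mat2 weber_matrix_mult)
qed

lemma weber_mat_cong:
  assumes "pcoset (reduction A :: 48^2^2) = pcoset (reduction B)"
  shows "weber_mat A = weber_mat B"
proof -
  obtain a b c d where A: "A = mat2 a b c d" by (rule mat2_cases)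
  obtain a' b' c' d' where B: "B = mat2 a' b' c' d'" by (rule mat2_cases)
  have "reduction A = (reduction B :: 48^2^2) \<or> reduction A = (reduction (- B) :: 48^2^2)"
    using assms by (auto simp: pcoset_eq reduction_uminus doubleton_eq_iff)
  then show ?thesis
  proof
    assume "reduction A = (reduction B :: 48^2^2)"
    then show ?thesis unfolding A B reduction_eq_mat2_iff by (simp add: weber_matrix_cong)
  next
    assume "reduction A = (reduction (- B) :: 48^2^2)"
    then have "weber_matrix a b c d = weber_matrix (- a') (- b') (- c') (- d')"
      unfolding A B uminus_mat2 reduction_eq_mat2_iff by (intro weber_matrix_cong) auto
    then show ?thesis by (simp add: A B weber_matrix_uminus)
  qed
qed

text \<open>For a coset in the carrier the chosen lift has determinant 1 only modulo 48;
  \<open>weber_mat_cong\<close> makes the value independent of the lift and of its sign.\<close>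

definition weber_rep :: "(48^2^2) set \<Rightarrow> complex^3^3" where
  "weber_rep C = weber_mat (SOME A. C = pcoset (reduction A))"

lemma weber_rep_pcoset: "weber_rep (pcoset (reduction A)) = weber_mat A"
proof -
  have "\<exists>B. pcoset (reduction A) = pcoset (reduction B :: 48^2^2)" by blast
  from someI_ex[OF this]
  have "pcoset (reduction A :: 48^2^2) = pcoset (reduction (SOME B. pcoset (reduction A) = pcoset (reduction B :: 48^2^2)))" .
  then show ?thesis unfolding weber_rep_def by (intro weber_mat_cong) (rule sym)
qed

lemma PSL2_48_cases:
  assumes "C \<in> carrier PSL2_48"
  obtains A where "C = pcoset (reduction A)" "[det A = 1] (mod 48)"
proof -
  obtain B :: "48^2^2" where B: "C = pcoset B" "det B = 1" using assms by (auto simp: carrier_PSL2)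
  obtain A where "B = reduction A" by (rule reduction_surj)
  with B show ?thesis using that det_reduction_48 by blast
qed

section \<open>Matrix entries in the field generated by zeta_24\<close>

lemma Q_adjoin_closed:
  shows Q_adjoin_generator: "z \<in> Q_adjoin z"
    and Q_adjoin_0: "0 \<in> Q_adjoin z" and Q_adjoin_1: "1 \<in> Q_adjoin z"
    and Q_adjoin_mult: "x \<in> Q_adjoin z \<Longrightarrow> y \<in> Q_adjoin z \<Longrightarrow> x * y \<in> Q_adjoin z"
    and Q_adjoin_inverse: "x \<in> Q_adjoin z \<Longrightarrow> inverse x \<in> Q_adjoin z"
proof -
  define R where "R = (ring_of_type_algebra :: complex ring)"
  have R: "\<one>\<^bsub>R\<^esub> = 1" "\<zero>\<^bsub>R\<^esub> = 0" "monoid.mult R = (*)" "add R = (+)" "carrier R = UNIV"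
    by (simp_all add: R_def ring_of_type_algebra_def)
  interpret field R unfolding R_def by (rule field_from_type_algebra)
  have Q: "Q_adjoin z = generate_field R {z}" for z by (simp add: Q_adjoin_def R_def)
  show "z \<in> Q_adjoin z" unfolding Q by (rule generate_field.incl) simp
  show one: "1 \<in> Q_adjoin z" unfolding Q using generate_field.one[of R "{z}"] by (simp add: R)
  have "\<ominus>\<^bsub>R\<^esub> 1 \<in> Q_adjoin z" using one unfolding Q by (rule generate_field.a_inv)
  then have "1 \<oplus>\<^bsub>R\<^esub> \<ominus>\<^bsub>R\<^esub> 1 \<in> Q_adjoin z" using one unfolding Q by (intro generate_field.eng_add)
  moreover have "1 \<oplus>\<^bsub>R\<^esub> \<ominus>\<^bsub>R\<^esub> 1 = 0" using r_neg[of 1] by (simp only: R) simp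
  ultimately show zero: "0 \<in> Q_adjoin z" by simp
  show "x * y \<in> Q_adjoin z" if "x \<in> Q_adjoin z" "y \<in> Q_adjoin z"
    using generate_field.eng_mult[of x R "{z}" y] that unfolding Q by (simp add: R)
  show "inverse x \<in> Q_adjoin z" if "x \<in> Q_adjoin z"
  proof (cases "x = 0")
    case True
    then show ?thesis using zero by simp
  next
    case False
    then have "inv\<^bsub>R\<^esub> x = inverse x" by (intro comm_inv_char) (simp_all add: R)
    with False that show ?thesis using generate_field.m_inv[of x R "{z}"] unfolding Q by (simp add: R)
  qed
qed

lemma Q_adjoin_power_int: "x \<in> Q_adjoin z \<Longrightarrow> x powi n \<in> Q_adjoin z"
proof -
  assume x: "x \<in> Q_adjoin z"
  have "y ^ m \<in> Q_adjoin z" if "y \<in> Q_adjoin z" for y m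
    by (induction m) (auto simp: Q_adjoin_1 intro: Q_adjoin_mult that)
  then show ?thesis by (auto simp: power_int_def intro: Q_adjoin_inverse x)
qed

lemma zeta_in_Q_adjoin_zeta_24: "zeta 8 \<in> Q_adjoin (zeta 24)" "zeta 3 \<in> Q_adjoin (zeta 24)"
  using zeta_mult_power[of 3 8] zeta_mult_power[of 8 3] Q_adjoin_power_int[OF Q_adjoin_generator, of "zeta 24" 3]
    Q_adjoin_power_int[OF Q_adjoin_generator, of "zeta 24" 8] by simp_all

text \<open>\<open>zeta 16\<close> lies outside this field, but its square \<open>zeta 8\<close> is
  a power of \<open>zeta 24\<close>; this is where the parity of \<open>theta16\<close>
  enters.\<close>

lemma zeta48_exp_in_Q_adjoin:
  assumes "even m"
  shows "zeta48_exp m n \<in> Q_adjoin (zeta 24)"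
proof -
  obtain k where k: "m = 2 * k" using assms by auto
  have "zeta 16 powi m = (zeta 16 ^ 2) powi k" by (simp add: k power_int_mult)
  then have "zeta 16 powi m = zeta 8 powi k" using zeta_mult_power[of 2 8] by simp
  then show ?thesis
    by (simp add: zeta48_exp_def Q_adjoin_mult Q_adjoin_power_int zeta_in_Q_adjoin_zeta_24)
qed

lemma bottom_row_in_Q_adjoin:
  assumes "odd c \<or> odd d"
  shows "bottom_row a b c d $ j \<in> Q_adjoin (zeta 24)"
proof -
  have "even (theta16 a b c d)" using assms by (auto simp: theta16_def)
  then have z: "zeta48_exp (theta16 a b c d) (theta3 a b c d) \<in> Q_adjoin (zeta 24)"
    by (rule zeta48_exp_in_Q_adjoin)
  show ?thesis using exhaust_3[of j]
    by (auto simp: bottom_row_def Let_def z Q_adjoin_0)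
qed

lemma weber_mat_entries:
  assumes "[det A = 1] (mod 48)"
  shows "weber_mat A $ i $ j \<in> Q_adjoin (zeta 24)"
proof -
  obtain a b c d where A: "A = mat2 a b c d" by (rule mat2_cases)
  have det: "[a * d - b * c = 1] (mod 48)" using assms by (simp add: A det_mat2)
  have "odd c \<or> odd d" using odd_bottom_row[OF det] by simp
  moreover have "odd a \<or> odd b" using odd_bottom_row[where a = "- c" and b = "- d" and c = a and d = b and n = 48] det by (simp add: algebra_simps)
  moreover have "odd (a + c) \<or> odd (b + d)"
    using odd_bottom_row[where a = "- c" and b = "- d" and c = "a + c" and d = "b + d" and n = 48] det
    by (simp add: algebra_simps)
  ultimately show ?thesis using exhaust_3[of i]
    by (auto simp: A weber_matrix_def divide_inverse power2_eq_square zeta_in_Q_adjoin_zeta_24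
        intro!: Q_adjoin_mult Q_adjoin_inverse Q_adjoin_generator Q_adjoin_1 bottom_row_in_Q_adjoin)
qed

lemma weber_mat_1: "weber_mat (mat 1) = mat 1"
  by (simp add: mat_1_eq_mat2[where 'a = int] weber_matrix_1)

lemma mult_GL3 [simp]: "monoid.mult (GL3 K) = (**)"
  by (simp add: GL3_def units_of_def)

lemma weber_mat_in_GL3:
  assumes "[det A = 1] (mod 48)"
  shows "weber_mat A \<in> carrier (GL3 (Q_adjoin (zeta 24)))"
proof -
  obtain a b c d where A: "A = mat2 a b c d" by (rule mat2_cases)
  \<comment> \<open>The adjugate. Its products with \<open>A\<close> are the scalar matrix of the
    determinant, which agrees with the unit matrix modulo 48.\<close>
  define B where "B = mat2 d (- b) (- c) a"
  have B: "[det B = 1] (mod 48)" using assms by (simp add: A B_def det_mat2 mult.commute)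
  have "A ** B = mat2 (a * d - b * c) 0 0 (a * d - b * c)" "B ** A = A ** B"
    by (simp_all add: A B_def mat2_mult mat2_eq_iff algebra_simps)
  moreover have "weber_mat (mat2 (a * d - b * c) 0 0 (a * d - b * c)) = weber_mat (mat 1)"
    using assms by (simp add: A det_mat2 mat_1_eq_mat2[where 'a = int] weber_matrix_cong)
  ultimately have "weber_mat A ** weber_mat B = mat 1" "weber_mat B ** weber_mat A = mat 1"
    using weber_mat_mult[OF assms B] weber_mat_mult[OF B assms] by (simp_all add: weber_mat_1)
  then show ?thesis
    unfolding GL3_def units_of_def Units_def
    using weber_mat_entries[OF assms] weber_mat_entries[OF B] by auto
qed

lemma weber_rep_hom: "weber_rep \<in> hom PSL2_48 (GL3 (Q_adjoin (zeta 24)))"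
proof (rule homI)
  fix C assume "C \<in> carrier PSL2_48"
  then obtain A where "C = pcoset (reduction A)" "[det A = 1] (mod 48)" by (rule PSL2_48_cases)
  then show "weber_rep C \<in> carrier (GL3 (Q_adjoin (zeta 24)))"
    by (simp add: weber_rep_pcoset weber_mat_in_GL3)
next
  fix C D assume "C \<in> carrier PSL2_48" "D \<in> carrier PSL2_48"
  then obtain A B where A: "C = pcoset (reduction A)" "[det A = 1] (mod 48)"
    and B: "D = pcoset (reduction B)" "[det B = 1] (mod 48)" by (elim PSL2_48_cases)
  then show "weber_rep (C \<otimes>\<^bsub>PSL2\<^esub> D) = weber_rep C \<otimes>\<^bsub>GL3 (Q_adjoin (zeta 24))\<^esub> weber_rep D"
    by (simp add: pcoset_mult det_reduction_48 weber_rep_pcoset weber_mat_mult flip: reduction_mult)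
qed

section \<open>Uniqueness and existence of \<iota>\<close>

lemma PSL2Z_cases:
  assumes "g \<in> carrier PSL2Z"
  obtains a b c d where "g = pcoset (mat2 a b c d)" "a * d - b * c = 1"
proof -
  obtain A :: "int^2^2" where A: "g = pcoset A" "det A = 1" using assms by (auto simp: carrier_PSL2)
  obtain a b c d where "A = mat2 a b c d" by (rule mat2_cases)
  with A that show ?thesis by (simp add: det_mat2)
qed

lemma psl_S_eq: "psl_S = pcoset (mat2 0 (-1) 1 0)" and psl_T_eq: "psl_T = pcoset (mat2 1 1 0 1)"
  by (simp_all add: psl_S_def psl_T_def psl_eq_pcoset mat2_def)

lemma PSL2Z_induct [consumes 1, case_names one S T]:
  assumes g: "g \<in> carrier PSL2Z"
    and one: "P \<one>\<^bsub>PSL2Z\<^esub>"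
    and S: "\<And>h. h \<in> carrier PSL2Z \<Longrightarrow> P h \<Longrightarrow> P (h \<otimes>\<^bsub>PSL2Z\<^esub> psl_S)"
    and T: "\<And>h. h \<in> carrier PSL2Z \<Longrightarrow> P h \<Longrightarrow> P (h \<otimes>\<^bsub>PSL2Z\<^esub> psl_T)"
  shows "P g"
proof -
  obtain a b c d where g: "g = pcoset (mat2 a b c d)" and det: "a * d - b * c = 1"
    using g by (rule PSL2Z_cases)
  have "P (pcoset (mat2 a b c d))"
  proof (induction a b c d rule: SL2_mod_induct[where n = 0])
    case 1
    then show ?case using one by (simp add: pcoset_one[symmetric] mat_1_eq_mat2)
  next
    case (2 a b c d)
    then have "P (pcoset (mat2 a b c d) \<otimes>\<^bsub>PSL2Z\<^esub> psl_S)" by (intro S) (simp_all add: det_mat2)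
    moreover have "pcoset (mat2 a b c d) \<otimes>\<^bsub>PSL2Z\<^esub> psl_S = pcoset (mat2 b (- a) d (- c))"
      using "2.hyps" by (simp add: psl_S_eq pcoset_mult det_mat2 mat2_mult)
    ultimately show ?case by simp
  next
    case (3 a b c d)
    then have "P (pcoset (mat2 a b c d) \<otimes>\<^bsub>PSL2Z\<^esub> psl_T)" by (intro T) (simp_all add: det_mat2)
    moreover have "pcoset (mat2 a b c d) \<otimes>\<^bsub>PSL2Z\<^esub> psl_T = pcoset (mat2 a (a + b) c (c + d))"
      using "3.hyps" by (simp add: psl_T_eq pcoset_mult det_mat2 mat2_mult)
    ultimately show ?case by simp
  next
    case (4 a b c d a' b' c' d')
    then show ?case by simp
  qed (use det in simp)
  then show ?thesis by (simp add: g)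
qed

lemma psl_S_T_in_PSL2Z: "psl_S \<in> carrier PSL2Z" "psl_T \<in> carrier PSL2Z"
  by (simp_all add: psl_S_eq psl_T_eq det_mat2)

lemma generate_S_T: "generate PSL2Z {psl_S, psl_T} = carrier PSL2Z"
proof
  interpret group PSL2Z by (rule group_PSL2)
  show "generate PSL2Z {psl_S, psl_T} \<subseteq> carrier PSL2Z"
    by (rule generate_incl) (use psl_S_T_in_PSL2Z in auto)
  show "carrier PSL2Z \<subseteq> generate PSL2Z {psl_S, psl_T}"
  proof
    fix g assume "g \<in> carrier PSL2Z"
    then show "g \<in> generate PSL2Z {psl_S, psl_T}"
      by (induction g rule: PSL2Z_induct) (auto intro: generate.intros)
  qed
qed

lemma weber_mat_S_T: "weber_mat (mat2 0 (-1) 1 0) = weber_S" "weber_mat (mat2 1 1 0 1) = weber_T"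
  using weber_matrix_S[of 1 1 0 0] weber_matrix_T[of 1 1 0 0] by (simp_all add: weber_matrix_1)

lemma weber_hom_eq_weber_mat:
  assumes "weber_hom \<iota>" "a * d - b * c = 1"
  shows "\<iota> (pcoset (mat2 a b c d)) = weber_matrix a b c d"
proof -
  have hom: "\<iota> (g \<otimes>\<^bsub>PSL2Z\<^esub> h) = \<iota> g ** \<iota> h" if "g \<in> carrier PSL2Z" "h \<in> carrier PSL2Z" for g h
    using assms(1) that by (auto simp: weber_hom_def hom_def)
  have ST: "\<iota> psl_S = weber_S" "\<iota> psl_T = weber_T"
    using assms(1) by (simp_all add: weber_hom_def weber_S_def weber_T_def)
  have rep: "weber_rep (reduce48 (pcoset (mat2 a b c d))) = weber_matrix a b c d" for a b c d
    by (simp add: reduce48_pcoset weber_rep_pcoset)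
  \<comment> \<open>\<open>hom\<close> asserts multiplicativity but not the value at the unit; that
    value is recovered from S^2 = 1 in the quotient and the square of
    \<open>weber_S\<close>.\<close>
  have S2: "psl_S \<otimes>\<^bsub>PSL2Z\<^esub> psl_S = \<one>\<^bsub>PSL2Z\<^esub>"
    by (simp add: psl_S_eq pcoset_mult det_mat2 mat2_mult pcoset_one[symmetric] mat_1_eq_mat2)
      (simp add: pcoset_eq uminus_mat2 insert_commute)
  have "\<iota> \<one>\<^bsub>PSL2Z\<^esub> = weber_S ** weber_S"
    using hom[OF psl_S_T_in_PSL2Z(1) psl_S_T_in_PSL2Z(1)] by (simp add: S2 ST)
  also have "\<dots> = mat 1"
    by (simp add: weber_S_def vec_eq_iff forall_3 matrix_matrix_mult_def sum_3 mat_def)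
  finally have \<iota>_one: "\<iota> \<one>\<^bsub>PSL2Z\<^esub> = mat 1" .
  have "pcoset (mat2 a b c d) \<in> carrier PSL2Z" using assms(2) by (simp add: det_mat2)
  \<comment> \<open>\<open>PSL2Z_induct\<close> speaks of cosets, so the right-hand side is first
    written as a function of the coset instead of the entries.\<close>
  then have "\<iota> (pcoset (mat2 a b c d)) = weber_rep (reduce48 (pcoset (mat2 a b c d)))"
  proof (induction rule: PSL2Z_induct)
    case one
    have "pcoset (mat2 1 0 0 1) = \<one>\<^bsub>PSL2Z\<^esub>" by (simp add: mat_1_eq_mat2 flip: pcoset_one)
    then show ?case using \<iota>_one rep[of 1 0 0 1] by (simp add: weber_matrix_1)
  next
    case (S h)
    then obtain a b c d where h: "h = pcoset (mat2 a b c d)" "a * d - b * c = 1" by (elim PSL2Z_cases)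
    then have "h \<otimes>\<^bsub>PSL2Z\<^esub> psl_S = pcoset (mat2 b (- a) d (- c))"
      by (simp add: psl_S_eq pcoset_mult det_mat2 mat2_mult)
    then have "weber_rep (reduce48 (h \<otimes>\<^bsub>PSL2Z\<^esub> psl_S)) = weber_rep (reduce48 h) ** weber_S"
      using h by (simp add: rep weber_matrix_S)
    with S show ?case by (simp add: hom psl_S_T_in_PSL2Z ST)
  next
    case (T h)
    then obtain a b c d where h: "h = pcoset (mat2 a b c d)" "a * d - b * c = 1" by (elim PSL2Z_cases)
    then have "h \<otimes>\<^bsub>PSL2Z\<^esub> psl_T = pcoset (mat2 a (a + b) c (c + d))"
      by (simp add: psl_T_eq pcoset_mult det_mat2 mat2_mult)
    then have "weber_rep (reduce48 (h \<otimes>\<^bsub>PSL2Z\<^esub> psl_T)) = weber_rep (reduce48 h) ** weber_T"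
      using h by (simp add: rep weber_matrix_T)
    with T show ?case by (simp add: hom psl_S_T_in_PSL2Z ST)
  qed
  then show ?thesis by (simp add: rep)
qed

text \<open>Existence of \<iota> comes from the explicit representation modulo 48, in place of
  checking the relations of a presentation by S and T.\<close>

lemma weber_hom_weber_rep: "weber_hom (weber_rep \<circ> reduce48)"
  unfolding weber_hom_def
proof (intro conjI)
  have "reduce48 \<in> hom PSL2Z PSL2_48"
  proof (rule homI)
    fix g h assume "g \<in> carrier PSL2Z" "h \<in> carrier PSL2Z"
    then show "reduce48 (g \<otimes>\<^bsub>PSL2Z\<^esub> h) = reduce48 g \<otimes>\<^bsub>PSL2_48\<^esub> reduce48 h"
      by (auto simp: carrier_PSL2 pcoset_mult reduce48_pcoset reduction_mult det_reduction)
  qed (auto simp: carrier_PSL2 reduce48_pcoset det_reduction)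
  then show "weber_rep \<circ> reduce48 \<in> hom PSL2Z (GL3 (Q_adjoin (zeta 24)))"
    using weber_rep_hom by (rule hom_compose)
  show "(weber_rep \<circ> reduce48) psl_S = vector [vector [1, 0, 0], vector [0, 0, inverse (zeta 8)], vector [0, zeta 8, 0]]"
    using weber_mat_S_T(1) by (simp add: psl_S_eq reduce48_pcoset weber_rep_pcoset weber_S_def)
  show "(weber_rep \<circ> reduce48) psl_T = vector [vector [0, zeta 24, 0], vector [inverse (zeta 24 ^ 2), 0, 0], vector [0, 0, zeta 24]]"
    using weber_mat_S_T(2) by (simp add: psl_T_eq reduce48_pcoset weber_rep_pcoset weber_T_def)
qed

section \<open>The permutations given by U, V and W\<close>

lemma psl_T_power: "psl_T [^]\<^bsub>PSL2Z\<^esub> (int k) = pcoset (mat2 1 (int k) 0 1)"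
  unfolding int_pow_int
proof (induction k)
  case 0
  then show ?case by (simp add: pcoset_one[symmetric] mat_1_eq_mat2)
next
  case (Suc k)
  then show ?case by (simp add: psl_T_eq pcoset_mult det_mat2 mat2_mult)
qed

lemma inv_pcoset:
  assumes "a * d - b * c = (1 :: int)"
  shows "inv\<^bsub>PSL2Z\<^esub> (pcoset (mat2 a b c d)) = pcoset (mat2 d (- b) (- c) a)"
  by (rule group.inv_equality[OF group_PSL2])
    (use assms in \<open>simp_all add: pcoset_mult det_mat2 mat2_mult pcoset_one[symmetric] mat_1_eq_mat2 algebra_simps\<close>)

lemma psl_U_eq: "psl_U = pcoset (mat2 (-1) (-2) 1 1)"
  by (simp add: psl_U_def psl_T_eq psl_S_eq inv_pcoset pcoset_mult det_mat2 mat2_mult)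

lemma psl_V_eq: "psl_V = pcoset (mat2 (-2) (-5) 1 2)"
proof -
  have "psl_T [^]\<^bsub>PSL2Z\<^esub> (2 :: int) = pcoset (mat2 1 2 0 1)" using psl_T_power[of 2] by simp
  moreover have "psl_T [^]\<^bsub>PSL2Z\<^esub> (-2 :: int) = inv\<^bsub>PSL2Z\<^esub> (psl_T [^]\<^bsub>PSL2Z\<^esub> (2 :: int))"
    by (rule group.int_pow_neg[OF group_PSL2 psl_S_T_in_PSL2Z(2)])
  ultimately show ?thesis
    by (simp add: psl_V_def psl_S_eq inv_pcoset pcoset_mult det_mat2 mat2_mult)
qed

lemma psl_W_eq: "psl_W = pcoset (mat2 0 (-1) 1 3)"
  using psl_T_power[of 3] by (simp add: psl_W_def psl_S_eq pcoset_mult det_mat2 mat2_mult)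

text \<open>For U, V and W the first row carries the root \<open>zeta 24\<close>, which this
  relation cancels against the prefactor \<open>zeta 24 ^ 2 / zeta 8\<close>.\<close>

lemma zeta_24_cubed: "zeta 24 * zeta 24 * zeta 24 = zeta 8"
  using zeta_mult_power[of 3 8] by (simp add: power3_eq_cube)

lemma weber_matrix_U: "weber_matrix (-1) (-2) 1 1 = vector [vector [0, 0, 1], vector [0, 1, 0], vector [1, 0, 0]]"
proof -
  \<comment> \<open>The arguments are the values of \<open>theta16\<close> and \<open>theta3\<close>
    on the first two rows; on the third row both vanish.\<close>
  have "zeta48_exp 6 (-1) = zeta 24" "zeta48_exp 2 (-3) = zeta 8"
    unfolding zeta48_exp_zeta_24 zeta48_exp_zeta_8 by (intro zeta48_exp_cong; simp add: cong_def)+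
  then show ?thesis
    by (simp add: weber_matrix_def bottom_row_def theta16_def theta3_def vec_eq_iff forall_3
        power2_eq_square zeta_24_cubed)
qed

lemma weber_matrix_V: "weber_matrix (-2) (-5) 1 2 = vector [vector [1, 0, 0], vector [0, 0, 1], vector [0, 1, 0]]"
proof -
  \<comment> \<open>Again one pair of exponents per row, reduced modulo 16 and 3; for the second row
    114 becomes 2 and 18 becomes 0.\<close>
  have "zeta48_exp 6 (-4) = zeta 24" "zeta48_exp 114 18 = zeta 8" "zeta48_exp (-16) 0 = zeta48_exp 0 0"
    unfolding zeta48_exp_zeta_24 zeta48_exp_zeta_8 by (intro zeta48_exp_cong; simp add: cong_def)+
  then show ?thesis
    by (simp add: weber_matrix_def bottom_row_def theta16_def theta3_def vec_eq_iff forall_3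
        power2_eq_square zeta_24_cubed)
qed

lemma weber_matrix_W: "weber_matrix 0 (-1) 1 3 = vector [vector [0, 1, 0], vector [0, 0, 1], vector [1, 0, 0]]"
proof -
  have "zeta48_exp (-10) (-1) = zeta 24" "zeta48_exp 18 (-3) = zeta 8" "zeta48_exp 0 (-3) = zeta48_exp 0 0"
    unfolding zeta48_exp_zeta_24 zeta48_exp_zeta_8 by (intro zeta48_exp_cong; simp add: cong_def)+
  then show ?thesis
    by (simp add: weber_matrix_def bottom_row_def theta16_def theta3_def vec_eq_iff forall_3
        power2_eq_square zeta_24_cubed)
qed

theorem proposition3:
  shows "(\<forall>\<tau>\<in>upper_half_plane.
            weber_triple (-1 / \<tau>) = vector [u0 \<tau>, zeta 8 * u2 \<tau>, inverse (zeta 8) * u1 \<tau>] \<and>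
            weber_triple (\<tau> + 1) =
              vector [inverse (zeta 12) * u1 \<tau>, zeta 24 * u0 \<tau>, zeta 24 * u2 \<tau>]) \<and>
         generate PSL2Z {psl_S, psl_T} = carrier PSL2Z \<and>
         (\<exists>\<iota>. weber_hom \<iota>) \<and>
         (\<forall>\<iota>. weber_hom \<iota> \<longrightarrow>
            (\<exists>\<rho> \<in> hom PSL2_48 (GL3 (Q_adjoin (zeta 24))).
               \<forall>g \<in> carrier PSL2Z. \<iota> g = \<rho> (reduce48 g) \<and>
                 (\<forall>\<tau>\<in>upper_half_plane.
                    weber_triple \<tau> v* \<iota> g = weber_triple \<tau> v* \<rho> (reduce48 g))) \<and>
            (\<forall>\<tau>\<in>upper_half_plane.
               weber_triple \<tau> v* \<iota> psl_U = vector [u2 \<tau>, u1 \<tau>, u0 \<tau>] \<and>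
               weber_triple \<tau> v* \<iota> psl_V = vector [u0 \<tau>, u2 \<tau>, u1 \<tau>] \<and>
               weber_triple \<tau> v* \<iota> psl_W = vector [u2 \<tau>, u0 \<tau>, u1 \<tau>]))"
proof (intro conjI allI impI ballI)
  show "generate PSL2Z {psl_S, psl_T} = carrier PSL2Z" by (rule generate_S_T)
  show "\<exists>\<iota>. weber_hom \<iota>" using weber_hom_weber_rep by blast
next
  fix \<iota> assume \<iota>: "weber_hom \<iota>"
  have "\<iota> g = weber_rep (reduce48 g)" if g: "g \<in> carrier PSL2Z" for g
  proof -
    obtain a b c d where "g = pcoset (mat2 a b c d)" "a * d - b * c = 1" using g by (rule PSL2Z_cases)
    then show ?thesis
      using weber_hom_eq_weber_mat[OF \<iota>] by (simp add: reduce48_pcoset weber_rep_pcoset)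
  qed
  then show "\<exists>\<rho> \<in> hom PSL2_48 (GL3 (Q_adjoin (zeta 24))). \<forall>g \<in> carrier PSL2Z. \<iota> g = \<rho> (reduce48 g) \<and>
      (\<forall>\<tau>\<in>upper_half_plane. weber_triple \<tau> v* \<iota> g = weber_triple \<tau> v* \<rho> (reduce48 g))"
    using weber_rep_hom by auto
  fix \<tau>
  show "weber_triple \<tau> v* \<iota> psl_U = vector [u2 \<tau>, u1 \<tau>, u0 \<tau>]"
    using weber_hom_eq_weber_mat[OF \<iota>, of "-1" 1 "-2" 1]
    by (simp add: psl_U_eq weber_matrix_U weber_triple_def vector_matrix_mult_3)
  show "weber_triple \<tau> v* \<iota> psl_V = vector [u0 \<tau>, u2 \<tau>, u1 \<tau>]"
    using weber_hom_eq_weber_mat[OF \<iota>, of "-2" 2 "-5" 1]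
    by (simp add: psl_V_eq weber_matrix_V weber_triple_def vector_matrix_mult_3)
  show "weber_triple \<tau> v* \<iota> psl_W = vector [u2 \<tau>, u0 \<tau>, u1 \<tau>]"
    using weber_hom_eq_weber_mat[OF \<iota>, of 0 3 "-1" 1]
    by (simp add: psl_W_eq weber_matrix_W weber_triple_def vector_matrix_mult_3)
qed (simp_all only: weber_triple_inversion weber_triple_add_1)

end
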